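(* Let $K$ be a field of characteristic zero, $A$ a commutative associative unital $K$-algebra, $(G,\rho)$ a Lie--Rinehart algebra over $A$, and $\mathcal G=\bigwedge_AG$ with its Schouten--Nijenhuis bracket $[\cdot,\cdot]_{SN}$. For all homogeneous $P\in\mathcal G^p$, $Q\in\mathcal G^q$, $R\in\mathcal G^r$, \[ (-1)^{(p-1)(r-1)}[P,[Q,R]_{SN}]_{SN}+(-1)^{(q-1)(p-1)}[Q,[R,P]_{SN}]_{SN}+(-1)^{(r-1)(q-1)}[R,[P,Q]_{SN}]_{SN}=0. \]
   Context: A Lie--Rinehart algebra over $A$ is an $A$-module $G$ endowed with a $K$-Lie bracket $[\cdot,\cdot]$ and an $A$-linear map $\rho:G\to\operatorname{Der}_K(A)$ (the anchor) that is a morphism of $K$-Lie algebras, such that $[x,ay]=a[x,y]+\rho(x)(a)y$ for all $a\in A$, $x,y\in G$. $\mathcal G=\bigwedge_AG=\bigoplus_{p\ge0}\mathcal G^p$ is the exterior algebra over $A$, $\mathcal G^p=\bigwedge_A^pG$, with $\mathcal G^0=A$, $\mathcal G^1=G$ and $\mathcal G^p=0$ for $p<0$. The Schouten--Nijenhuis bracket $[\cdot,\cdot]_{SN}$ is the (well-defined) $K$-bilinear map $\mathcal G\times\mathcal G\to\mathcal G$ given on decomposable elements as follows. For $X=x_1\wedge\cdots\wedge x_p$ and $Y=y_1\wedge\cdots\wedge y_q$ with $x_i,y_j\in G$, let $\widehat X_i$ be $X$ with the factor $x_i$ omitted ($\widehat X_1=1$ if $p=1$), and similarly $\widehat Y_j$.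 For $p,q\ge1$, \[ [X,Y]_{SN}=\sum_{i=1}^p\sum_{j=1}^q(-1)^{i+j}[x_i,y_j]\wedge\widehat X_i\wedge\widehat Y_j . \] For $a\in A$ and $p\ge1$, \[ [X,a]_{SN}=\sum_{i=1}^p(-1)^{p-i}\rho(x_i)(a)\,\widehat X_i,\qquad [a,X]_{SN}=\sum_{i=1}^p(-1)^{i}\rho(x_i)(a)\,\widehat X_i . \] For $a,b\in A$, $[a,b]_{SN}=0$. *)

theory Defs
  imports
    "HOL-Library.Poly_Mapping"
    "HOL-Algebra.Algebraic_Closure_Type"
begin

text \<open>
  \<open>K\<close>, \<open>A\<close> and \<open>G\<close> are the types \<open>'k\<close>, \<open>'a\<close> and \<open>'g\<close>; \<open>sK\<close> is the action of \<open>K\<close> on \<open>A\<close> and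
  \<open>sA\<close> the action of \<open>A\<close> on \<open>G\<close>. The exterior algebra depends on \<open>sA\<close>, so it cannot be a
  type; it is a quotient ring whose elements are cosets.
\<close>

section \<open>Lie--Rinehart algebras\<close>

definition scale_via ::
    "('k::field \<Rightarrow> 'a::comm_ring_1 \<Rightarrow> 'a) \<Rightarrow> ('a \<Rightarrow> 'g::ab_group_add \<Rightarrow> 'g) \<Rightarrow> 'k \<Rightarrow> 'g \<Rightarrow> 'g"
  where "scale_via sK sA c x = sA (sK c 1) x"

definition derivations :: "('k::field \<Rightarrow> 'a::comm_ring_1 \<Rightarrow> 'a) \<Rightarrow> ('a \<Rightarrow> 'a) set"
  where "derivations sK =
    {D. Vector_Spaces.linear sK sK D \<and> (\<forall>a b. D (a * b) = a * D b + D a * b)}"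

locale assoc_algebra = vector_space sK
  for sK :: "'k::field \<Rightarrow> 'a::comm_ring_1 \<Rightarrow> 'a" +
  assumes scale_mult_left: "sK c (a * b) = sK c a * b"

locale lie_rinehart =
  A: assoc_algebra sK + G: Modules.module sA
  for sK :: "'k::field \<Rightarrow> 'a::comm_ring_1 \<Rightarrow> 'a"
    and sA :: "'a \<Rightarrow> 'g::ab_group_add \<Rightarrow> 'g" +
  fixes br :: "'g \<Rightarrow> 'g \<Rightarrow> 'g"
    and \<rho> :: "'g \<Rightarrow> 'a \<Rightarrow> 'a"
  assumes br_linear_right: "Vector_Spaces.linear (scale_via sK sA) (scale_via sK sA) (\<lambda>y. br x y)"
    and br_linear_left: "Vector_Spaces.linear (scale_via sK sA) (scale_via sK sA) (\<lambda>x. br x y)"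
    and br_self: "br x x = 0"
    and br_jacobi: "br x (br y z) + br y (br z x) + br z (br x y) = 0"
    and anchor_derivation: "\<rho> x \<in> derivations sK"
    and anchor_add: "\<rho> (x + y) a = \<rho> x a + \<rho> y a"
    and anchor_scale: "\<rho> (sA b x) a = b * \<rho> x a"
    and anchor_br: "\<rho> (br x y) a = \<rho> x (\<rho> y a) - \<rho> y (\<rho> x a)"
    and br_leibniz: "br x (sA a y) = sA a (br x y) + sA (\<rho> x a) y"

section \<open>The exterior algebra\<close>

text \<open>
  Lists under concatenation, wrapped so as to carry the (additively written) monoid structure
  that turns \<open>'g gword \<Rightarrow>\<^sub>0 'a\<close> into the free associative \<open>A\<close>-algebra on the set \<open>G\<close>.
\<close>

datatype 'g gword = GWord (letters: "'g list")

instantiation gword :: (type) monoid_add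
begin

definition zero_gword :: "'a gword" where "zero_gword = GWord []"

definition plus_gword :: "'a gword \<Rightarrow> 'a gword \<Rightarrow> 'a gword"
  where "plus_gword u v = GWord (letters u @ letters v)"

instance
  by standard (simp_all add: zero_gword_def plus_gword_def)

end

type_synonym ('g, 'a) free_alg = "'g gword \<Rightarrow>\<^sub>0 'a"

text \<open>
  The first two families of relations cut the free algebra down to the tensor algebra of the
  \<open>A\<close>-module \<open>G\<close>, the third one is \<open>x \<otimes> x = 0\<close>.
\<close>

definition ext_relations :: "('a::comm_ring_1 \<Rightarrow> 'g::ab_group_add \<Rightarrow> 'g) \<Rightarrow> ('g, 'a) free_alg set"
  where "ext_relations sA =
    {Poly_Mapping.single (GWord [x + y]) 1 - Poly_Mapping.single (GWord [x]) 1
       - Poly_Mapping.single (GWord [y]) 1 | x y. True} \<union>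
    {Poly_Mapping.single (GWord [sA a x]) 1 - Poly_Mapping.single (GWord [x]) a | a x. True} \<union>
    {Poly_Mapping.single (GWord [x, x]) 1 | x. True}"

definition ext_ideal :: "('a::comm_ring_1 \<Rightarrow> 'g::ab_group_add \<Rightarrow> 'g) \<Rightarrow> ('g, 'a) free_alg set"
  where "ext_ideal sA = genideal ring_of_type_algebra (ext_relations sA)"

definition ext_alg :: "('a::comm_ring_1 \<Rightarrow> 'g::ab_group_add \<Rightarrow> 'g) \<Rightarrow> ('g, 'a) free_alg set ring"
  where "ext_alg sA = ring_of_type_algebra Quot ext_ideal sA"

definition ext_class ::
    "('a::comm_ring_1 \<Rightarrow> 'g::ab_group_add \<Rightarrow> 'g) \<Rightarrow> ('g, 'a) free_alg \<Rightarrow> ('g, 'a) free_alg set"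
  where "ext_class sA t = ext_ideal sA +>\<^bsub>ring_of_type_algebra\<^esub> t"

lemma ring_from_ring_1: "ring (ring_of_type_algebra :: 'b::ring_1 ring)"
proof -
  have "\<exists>y. x + y = 0" for x :: 'b
    using add.right_inverse by blast
  then show ?thesis
    unfolding ring_of_type_algebra_def using add.right_inverse
    by unfold_locales (auto simp: algebra_simps Units_def)
qed

lemma ideal_ext_ideal:
  fixes sA :: "'a::comm_ring_1 \<Rightarrow> 'g::ab_group_add \<Rightarrow> 'g"
  shows "ideal (ext_ideal sA) ring_of_type_algebra"
proof -
  interpret ring "ring_of_type_algebra :: ('g, 'a) free_alg ring"
    by (rule ring_from_ring_1)
  show ?thesis
    unfolding ext_ideal_def by (rule genideal_ideal) (simp add: ring_of_type_algebra_def)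
qed

lemma ring_ext_alg: "ring (ext_alg sA)"
  unfolding ext_alg_def by (rule ideal.quotient_is_ring[OF ideal_ext_ideal])

definition ext_of_A :: "('a::comm_ring_1 \<Rightarrow> 'g::ab_group_add \<Rightarrow> 'g) \<Rightarrow> 'a \<Rightarrow> ('g, 'a) free_alg set"
  where "ext_of_A sA a = ext_class sA (Poly_Mapping.single 0 a)"

definition ext_of_G :: "('a::comm_ring_1 \<Rightarrow> 'g::ab_group_add \<Rightarrow> 'g) \<Rightarrow> 'g \<Rightarrow> ('g, 'a) free_alg set"
  where "ext_of_G sA x = ext_class sA (Poly_Mapping.single (GWord [x]) 1)"

definition ext_scale ::
    "('a::comm_ring_1 \<Rightarrow> 'g::ab_group_add \<Rightarrow> 'g) \<Rightarrow> 'a \<Rightarrow> ('g, 'a) free_alg set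
      \<Rightarrow> ('g, 'a) free_alg set"
  where "ext_scale sA a U = ext_of_A sA a \<otimes>\<^bsub>ext_alg sA\<^esub> U"

definition ext_scaleK ::
    "('k::field \<Rightarrow> 'a::comm_ring_1 \<Rightarrow> 'a) \<Rightarrow> ('a \<Rightarrow> 'g::ab_group_add \<Rightarrow> 'g) \<Rightarrow> 'k \<Rightarrow> ('g, 'a) free_alg set
      \<Rightarrow> ('g, 'a) free_alg set"
  where "ext_scaleK sK sA c U = ext_scale sA (sK c 1) U"

definition wedge ::
    "('a::comm_ring_1 \<Rightarrow> 'g::ab_group_add \<Rightarrow> 'g) \<Rightarrow> 'g list \<Rightarrow> ('g, 'a) free_alg set"
  where "wedge sA xs = foldr (\<lambda>x U. ext_of_G sA x \<otimes>\<^bsub>ext_alg sA\<^esub> U) xs \<one>\<^bsub>ext_alg sA\<^esub>"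

text \<open>
  The image of the degree \<open>p\<close> part of the free algebra. For \<open>p < 0\<close> only \<open>t = 0\<close> qualifies, so the
  component is zero.
\<close>

definition ext_power ::
    "('a::comm_ring_1 \<Rightarrow> 'g::ab_group_add \<Rightarrow> 'g) \<Rightarrow> int \<Rightarrow> ('g, 'a) free_alg set set"
  where "ext_power sA p =
    ext_class sA ` {t. \<forall>w \<in> Poly_Mapping.keys t. int (length (letters w)) = p}"

section \<open>The Schouten--Nijenhuis bracket\<close>

definition omit :: "nat \<Rightarrow> 'b list \<Rightarrow> 'b list"
  where "omit i xs = take i xs @ drop (Suc i) xs"

definition ext_K_linear ::
    "('k::field \<Rightarrow> 'a::comm_ring_1 \<Rightarrow> 'a) \<Rightarrow> ('a \<Rightarrow> 'g::ab_group_add \<Rightarrow> 'g)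
      \<Rightarrow> (('g, 'a) free_alg set \<Rightarrow> ('g, 'a) free_alg set) \<Rightarrow> bool"
  where "ext_K_linear sK sA f \<longleftrightarrow>
    f \<in> carrier (ext_alg sA) \<rightarrow> carrier (ext_alg sA) \<and>
    (\<forall>U \<in> carrier (ext_alg sA). \<forall>V \<in> carrier (ext_alg sA).
      f (U \<oplus>\<^bsub>ext_alg sA\<^esub> V) = f U \<oplus>\<^bsub>ext_alg sA\<^esub> f V) \<and>
    (\<forall>c. \<forall>U \<in> carrier (ext_alg sA). f (ext_scaleK sK sA c U) = ext_scaleK sK sA c (f U))"

text \<open>
  List positions start at \<open>0\<close>, so the factor \<open>x\<^sub>i\<close> of the usual formulas is \<open>xs ! (i - 1)\<close>; this is
  why the index enters the signs as \<open>Suc i\<close>.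
\<close>

definition is_schouten_bracket ::
    "('k::field \<Rightarrow> 'a::comm_ring_1 \<Rightarrow> 'a) \<Rightarrow> ('a \<Rightarrow> 'g::ab_group_add \<Rightarrow> 'g)
      \<Rightarrow> ('g \<Rightarrow> 'g \<Rightarrow> 'g) \<Rightarrow> ('g \<Rightarrow> 'a \<Rightarrow> 'a)
      \<Rightarrow> (('g, 'a) free_alg set \<Rightarrow> ('g, 'a) free_alg set \<Rightarrow> ('g, 'a) free_alg set) \<Rightarrow> bool"
  where "is_schouten_bracket sK sA br \<rho> B \<longleftrightarrow>
    (\<forall>U \<in> carrier (ext_alg sA). ext_K_linear sK sA (\<lambda>V. B U V)) \<and>
    (\<forall>V \<in> carrier (ext_alg sA). ext_K_linear sK sA (\<lambda>U. B U V)) \<and>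
    (\<forall>xs ys. xs \<noteq> [] \<longrightarrow> ys \<noteq> [] \<longrightarrow>
      B (wedge sA xs) (wedge sA ys) =
        (\<Oplus>\<^bsub>ext_alg sA\<^esub>i\<in>{..<length xs}. \<Oplus>\<^bsub>ext_alg sA\<^esub>j\<in>{..<length ys}.
          ext_scale sA ((-1) ^ (Suc i + Suc j))
            (ext_of_G sA (br (xs ! i) (ys ! j)) \<otimes>\<^bsub>ext_alg sA\<^esub> wedge sA (omit i xs)
              \<otimes>\<^bsub>ext_alg sA\<^esub> wedge sA (omit j ys)))) \<and>
    (\<forall>xs a. xs \<noteq> [] \<longrightarrow>
      B (wedge sA xs) (ext_of_A sA a) =
        (\<Oplus>\<^bsub>ext_alg sA\<^esub>i\<in>{..<length xs}.
          ext_scale sA ((-1) ^ (length xs - Suc i) * \<rho> (xs ! i) a) (wedge sA (omit i xs)))) \<and>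
    (\<forall>a xs. xs \<noteq> [] \<longrightarrow>
      B (ext_of_A sA a) (wedge sA xs) =
        (\<Oplus>\<^bsub>ext_alg sA\<^esub>i\<in>{..<length xs}.
          ext_scale sA ((-1) ^ Suc i * \<rho> (xs ! i) a) (wedge sA (omit i xs)))) \<and>
    (\<forall>a b. B (ext_of_A sA a) (ext_of_A sA b) = \<zero>\<^bsub>ext_alg sA\<^esub>)"

text \<open>
  The choice only concerns arguments outside the carrier: every element of the exterior algebra is
  a sum of some \<open>a \<in> A\<close> and of wedges of nonempty lists, so the conditions determine the bracket on
  the carrier.
\<close>

definition schouten ::
    "('k::field \<Rightarrow> 'a::comm_ring_1 \<Rightarrow> 'a) \<Rightarrow> ('a \<Rightarrow> 'g::ab_group_add \<Rightarrow> 'g)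
      \<Rightarrow> ('g \<Rightarrow> 'g \<Rightarrow> 'g) \<Rightarrow> ('g \<Rightarrow> 'a \<Rightarrow> 'a)
      \<Rightarrow> ('g, 'a) free_alg set \<Rightarrow> ('g, 'a) free_alg set \<Rightarrow> ('g, 'a) free_alg set"
  where "schouten sK sA br \<rho> = (SOME B. is_schouten_bracket sK sA br \<rho> B)"

end

theory Submission
  imports Defs
begin

text \<open>
  Work with representatives in the free algebra, modulo the ideal of relations. For fixed \<open>P\<close> the
  map \<open>[P, -]\<close> is a graded derivation, hence determined by its values \<open>[P, a]\<close> and \<open>[P, y]\<close> on
  \<open>a \<in> A\<close> and \<open>y \<in> G\<close>, which are (up to sign) the contraction of \<open>P\<close> with \<open>da\<close> and the Lie
  derivative \<open>L\<^sub>y P\<close>. Defining the bracket by this recursion makes compatibility with the relations a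
  check on generators. The Jacobi identity in the form
  \<open>[P, [Q, R]] = [[P, Q], R] \<plusminus> [Q, [P, R]]\<close> compares graded derivations in \<open>R\<close>, so it suffices
  to take \<open>R \<in> A \<union> G\<close>; by graded antisymmetry it then says that \<open>L\<^sub>y\<close> and the contraction with
  \<open>da\<close> are derivations of the bracket, which is shown by the same recursion in \<open>Q\<close>.
\<close>

section \<open>The free algebra\<close>

definition scal :: "'a::comm_ring_1 \<Rightarrow> ('g, 'a) free_alg"
  where "scal a = Poly_Mapping.single 0 a"

definition gen :: "'g \<Rightarrow> ('g, 'a::comm_ring_1) free_alg"
  where "gen x = Poly_Mapping.single (GWord [x]) 1"

definition word :: "'g list \<Rightarrow> ('g, 'a::comm_ring_1) free_alg"
  where "word xs = Poly_Mapping.single (GWord xs) 1"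

lemma scal_0 [simp]: "scal 0 = 0" and scal_1 [simp]: "scal 1 = 1"
  and scal_add: "scal (a + b) = scal a + scal b" and scal_minus: "scal (- a) = - scal a"
  and scal_diff: "scal (a - b) = scal a - scal b" and scal_mult: "scal (a * b) = scal a * scal b"
  by (simp_all add: scal_def single_one single_add single_uminus single_diff mult_single)

lemma word_Nil [simp]: "word [] = 1" and word_Cons: "word (x # xs) = gen x * word xs"
  by (simp_all add: word_def gen_def mult_single plus_gword_def zero_gword_def[symmetric])

lemma single_eq_scal_word: "Poly_Mapping.single (GWord xs) a = scal a * word xs"
  by (simp add: scal_def word_def mult_single)

lemma single_Cons: "Poly_Mapping.single (GWord (x # xs)) a = gen x * Poly_Mapping.single (GWord xs) a"
  by (simp add: gen_def mult_single plus_gword_def)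

lemma free_alg_sum_singles:
  fixes u :: "('g, 'a::comm_ring_1) free_alg"
  shows "(\<Sum>w\<in>Poly_Mapping.keys u. Poly_Mapping.single w (Poly_Mapping.lookup u w)) = u"
  by (rule poly_mapping_eqI)
    (simp add: lookup_sum lookup_single when_def sum.delta' in_keys_iff)

lemma free_alg_single_induct [case_names single add]:
  assumes single: "\<And>xs a. P (Poly_Mapping.single (GWord xs) a)"
    and add: "\<And>u v. P u \<Longrightarrow> P v \<Longrightarrow> P (u + v)"
  shows "P (u :: ('g, 'a::comm_ring_1) free_alg)"
proof -
  have "P (\<Sum>w\<in>S. Poly_Mapping.single w (Poly_Mapping.lookup u w))" if "finite S" for S
    using that
  proof (induction S)
    case empty
    then show ?case using single[of "[]" 0] by simp
  next
    case (insert w S)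
    then show ?case using single[of "letters w"] by (auto intro!: add)
  qed
  from this[of "Poly_Mapping.keys u"] show ?thesis by (simp add: free_alg_sum_singles)
qed

text \<open>Monomials are peeled from the left and the coefficient is reached last, as in the
  recursion \<open>rec_word\<close>.\<close>

lemma free_alg_induct [case_names scal gen add]:
  assumes scal: "\<And>a. P (scal a)" and gen: "\<And>x u. P u \<Longrightarrow> P (gen x * u)"
    and add: "\<And>u v. P u \<Longrightarrow> P v \<Longrightarrow> P (u + v)"
  shows "P (u :: ('g, 'a::comm_ring_1) free_alg)"
proof (induction u rule: free_alg_single_induct)
  case (single xs a)
  show ?case
    by (induction xs) (use scal gen in \<open>auto simp: single_Cons scal_def zero_gword_def\<close>)
qed (rule add)

lemma scal_commute: "u * scal a = scal a * u"
proof (induction u rule: free_alg_single_induct)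
  case (single xs b)
  then show ?case by (simp add: scal_def mult_single mult.commute)
qed (simp add: distrib_left distrib_right)

text \<open>As rewrite rules these collect scalars in front. \<open>NO_MATCH\<close> stops the
  endless swapping of two scalars, which is left to the ordered rules
  \<open>scal_ac\<close>.\<close>

lemma move_scal:
  shows "NO_MATCH (scal b) u \<Longrightarrow> u * scal a = scal a * u"
    and "NO_MATCH (scal b) u \<Longrightarrow> u * (scal a * v) = scal a * (u * v)"
   by (rule scal_commute) (metis scal_commute mult.assoc)

lemma scal_ac:
  shows "scal a * scal b = scal b * scal a" and "scal a * (scal b * u) = scal b * (scal a * u)"
  by (rule scal_commute) (metis scal_commute mult.assoc)

subsection \<open>Recursion over the free algebra\<close>

text \<open>
  The coefficient is kept behind the last letter. Because of this the recursion equations of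
  \<open>free_rec\<close> below are equalities in the free algebra and not just modulo the relations.
\<close>

primrec rec_word :: "('p \<Rightarrow> 'p) \<Rightarrow> ('p \<Rightarrow> 'a \<Rightarrow> ('g, 'a::comm_ring_1) free_alg)
    \<Rightarrow> ('p \<Rightarrow> 'g \<Rightarrow> ('g, 'a) free_alg) \<Rightarrow> 'a \<Rightarrow> 'g list \<Rightarrow> 'p \<Rightarrow> ('g, 'a) free_alg"
  where
    "rec_word \<sigma> f k a [] = (\<lambda>p. f p a)"
  | "rec_word \<sigma> f k a (x # xs) = (\<lambda>p. k p x * Poly_Mapping.single (GWord xs) a
       + gen x * rec_word \<sigma> f k a xs (\<sigma> p))"

definition free_rec :: "('p \<Rightarrow> 'p) \<Rightarrow> ('p \<Rightarrow> 'a \<Rightarrow> ('g, 'a::comm_ring_1) free_alg)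
    \<Rightarrow> ('p \<Rightarrow> 'g \<Rightarrow> ('g, 'a) free_alg) \<Rightarrow> 'p \<Rightarrow> ('g, 'a) free_alg \<Rightarrow> ('g, 'a) free_alg"
  where "free_rec \<sigma> f k p u =
    (\<Sum>w\<in>Poly_Mapping.keys u. rec_word \<sigma> f k (Poly_Mapping.lookup u w) (letters w) p)"

context
  fixes \<sigma> :: "'p \<Rightarrow> 'p" and f :: "'p \<Rightarrow> 'a::comm_ring_1 \<Rightarrow> ('g, 'a) free_alg"
    and k :: "'p \<Rightarrow> 'g \<Rightarrow> ('g, 'a) free_alg"
  assumes f_add: "\<And>p a b. f p (a + b) = f p a + f p b"
begin

lemma rec_word_add:
  "rec_word \<sigma> f k (a + b) xs p = rec_word \<sigma> f k a xs p + rec_word \<sigma> f k b xs p"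
  by (induction xs arbitrary: p) (simp_all add: f_add single_add algebra_simps)

lemma rec_word_0: "rec_word \<sigma> f k 0 xs p = 0"
  using rec_word_add[of 0 0] by simp

text \<open>Coefficients may cancel in \<open>u + v\<close>, so supports differ. Sums over a common
  finite superset of the keys are comparable because \<open>rec_word\<close> vanishes at coefficient
  0.\<close>

lemma free_rec_superset:
  assumes "finite S" "Poly_Mapping.keys u \<subseteq> S"
  shows "free_rec \<sigma> f k p u = (\<Sum>w\<in>S. rec_word \<sigma> f k (Poly_Mapping.lookup u w) (letters w) p)"
  unfolding free_rec_def using assms
  by (intro sum.mono_neutral_left) (auto simp: in_keys_iff rec_word_0)

lemma free_rec_add: "free_rec \<sigma> f k p (u + v) = free_rec \<sigma> f k p u + free_rec \<sigma> f k p v"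
proof -
  let ?S = "Poly_Mapping.keys u \<union> Poly_Mapping.keys v"
  have "Poly_Mapping.keys (u + v) \<subseteq> ?S" by (rule keys_add)
  then show ?thesis
    by (simp add: free_rec_superset[of ?S] lookup_add rec_word_add sum.distrib)
qed

lemma free_rec_single:
  "free_rec \<sigma> f k p (Poly_Mapping.single (GWord xs) a) = rec_word \<sigma> f k a xs p"
  by (simp add: free_rec_superset[of "{GWord xs}"] )

lemma free_rec_scal: "free_rec \<sigma> f k p (scal a) = f p a"
  by (simp add: scal_def zero_gword_def free_rec_single)

lemma free_rec_gen:
  "free_rec \<sigma> f k p (gen x * u) = k p x * u + gen x * free_rec \<sigma> f k (\<sigma> p) u"
proof (induction u rule: free_alg_single_induct)
  case (single xs a)
  then show ?case by (simp add: single_Cons[symmetric] free_rec_single)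
next
  case (add u v)
  then show ?case by (simp add: free_rec_add distrib_left algebra_simps)
qed

end

section \<open>Congruence modulo the relations of the exterior algebra\<close>

definition ext_eq ::
    "('a::comm_ring_1 \<Rightarrow> 'g::ab_group_add \<Rightarrow> 'g) \<Rightarrow> ('g, 'a) free_alg \<Rightarrow> ('g, 'a) free_alg \<Rightarrow> bool"
  where "ext_eq sA u v \<longleftrightarrow> u - v \<in> ext_ideal sA"

lemma ext_ideal_zero: "0 \<in> ext_ideal sA"
  and ext_ideal_add: "u \<in> ext_ideal sA \<Longrightarrow> v \<in> ext_ideal sA \<Longrightarrow> u + v \<in> ext_ideal sA"
  and ext_ideal_mult_left: "u \<in> ext_ideal sA \<Longrightarrow> s * u \<in> ext_ideal sA"
  and ext_ideal_mult_right: "u \<in> ext_ideal sA \<Longrightarrow> u * s \<in> ext_ideal sA"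
proof -
  interpret ideal "ext_ideal sA" ring_of_type_algebra by (rule ideal_ext_ideal)
  show "0 \<in> ext_ideal sA" using additive_subgroup.zero_closed[OF additive_subgroup_axioms] by (simp add: ring_of_type_algebra_def)
  show "u + v \<in> ext_ideal sA" if "u \<in> ext_ideal sA" "v \<in> ext_ideal sA"
    using additive_subgroup.a_closed[OF additive_subgroup_axioms that] by (simp add: ring_of_type_algebra_def)
  show "s * u \<in> ext_ideal sA" if "u \<in> ext_ideal sA"
    using I_l_closed[OF that, of s] by (simp add: ring_of_type_algebra_def)
  show "u * s \<in> ext_ideal sA" if "u \<in> ext_ideal sA"
    using I_r_closed[OF that, of s] by (simp add: ring_of_type_algebra_def)
qed

lemma ext_ideal_uminus: "u \<in> ext_ideal sA \<Longrightarrow> - u \<in> ext_ideal sA"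
  using ext_ideal_mult_left[of u sA "- 1"] by simp

lemma ext_ideal_diff: "u \<in> ext_ideal sA \<Longrightarrow> v \<in> ext_ideal sA \<Longrightarrow> u - v \<in> ext_ideal sA"
  using ext_ideal_add[of u sA "- v"] ext_ideal_uminus[of v sA] by simp

lemma ext_relations_alt: "ext_relations sA =
    {gen (x + y) - gen x - gen y | x y. True} \<union>
    {gen (sA a x) - scal a * gen x | a x. True} \<union> {gen x * gen x | x. True}"
  by (simp add: ext_relations_def gen_def scal_def mult_single plus_gword_def zero_gword_def)

lemma ext_relations_in_ideal: "ext_relations sA \<subseteq> ext_ideal sA"
  unfolding ext_ideal_def by (rule ring.genideal_self[OF ring_from_ring_1])
    (simp add: ring_of_type_algebra_def)

text \<open>The elements satisfying \<open>P\<close> form a two-sided ideal containing the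
  relations, hence include the ideal generated by them. Closure under negation comes from
  multiplication by \<open>- 1\<close>.\<close>

lemma ext_ideal_induct [consumes 1, case_names relation zero add mult_left mult_right]:
  fixes sA :: "'a::comm_ring_1 \<Rightarrow> 'g::ab_group_add \<Rightarrow> 'g"
  assumes "u \<in> ext_ideal sA" and relation: "\<And>u. u \<in> ext_relations sA \<Longrightarrow> P u" and zero: "P 0"
    and add: "\<And>u v. P u \<Longrightarrow> P v \<Longrightarrow> P (u + v)"
    and left: "\<And>s u. P u \<Longrightarrow> P (s * u)" and right: "\<And>s u. P u \<Longrightarrow> P (u * s)"
  shows "P u"
proof -
  let ?R = "ring_of_type_algebra :: ('g, 'a) free_alg ring"
  have minus: "P (- u)" if "P u" for u
    using left[OF that, of "- 1"] by simp
  interpret R: ring ?R by (rule ring_from_ring_1)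
  have inv: "inv\<^bsub>add_monoid ?R\<^esub> x = - x" for x
    by (rule R.minus_equality[unfolded a_inv_def]) (simp_all add: ring_of_type_algebra_def)
  have "ideal {u. P u} ?R"
  proof (rule idealI)
    show "subgroup {u. P u} (add_monoid ?R)"
      by (rule group.subgroupI[OF R.add.is_group])
        (use zero add minus inv in \<open>auto simp: ring_of_type_algebra_def\<close>)
  qed (use R.ring_axioms left right in \<open>auto simp: ring_of_type_algebra_def\<close>)
  then have "genideal ?R (ext_relations sA) \<subseteq> {u. P u}"
    by (rule R.genideal_minimal) (use relation in auto)
  with assms(1) show ?thesis unfolding ext_ideal_def by auto
qed

lemma ext_eqI: "u - v = d \<Longrightarrow> d \<in> ext_ideal sA \<Longrightarrow> ext_eq sA u v"
  by (simp add: ext_eq_def)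

lemma ext_eq_refl [simp]: "ext_eq sA u u"
  by (simp add: ext_eq_def ext_ideal_zero)

lemma ext_eq_sym: "ext_eq sA u v \<Longrightarrow> ext_eq sA v u"
  unfolding ext_eq_def using ext_ideal_uminus[of "u - v" sA] by simp

lemma ext_eq_trans [trans]: "ext_eq sA u v \<Longrightarrow> ext_eq sA v w \<Longrightarrow> ext_eq sA u w"
  unfolding ext_eq_def using ext_ideal_add[of "u - v" sA "v - w"] by simp

lemma eq_ext_eq_trans [trans]: "u = v \<Longrightarrow> ext_eq sA v w \<Longrightarrow> ext_eq sA u w"
  and ext_eq_eq_trans [trans]: "ext_eq sA u v \<Longrightarrow> v = w \<Longrightarrow> ext_eq sA u w"
  by simp_all

lemma ext_eq_add: "ext_eq sA u u' \<Longrightarrow> ext_eq sA v v' \<Longrightarrow> ext_eq sA (u + v) (u' + v')"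
  unfolding ext_eq_def using ext_ideal_add[of "u - u'" sA "v - v'"] by (simp add: algebra_simps)

lemma ext_eq_uminus: "ext_eq sA u u' \<Longrightarrow> ext_eq sA (- u) (- u')"
  unfolding ext_eq_def using ext_ideal_uminus[of "u - u'" sA] by simp

lemma ext_eq_diff: "ext_eq sA u u' \<Longrightarrow> ext_eq sA v v' \<Longrightarrow> ext_eq sA (u - v) (u' - v')"
  unfolding ext_eq_def using ext_ideal_diff[of "u - u'" sA "v - v'"] by (simp add: algebra_simps)

lemma ext_eq_mult: "ext_eq sA u u' \<Longrightarrow> ext_eq sA v v' \<Longrightarrow> ext_eq sA (u * v) (u' * v')"
  unfolding ext_eq_def
  using ext_ideal_add[OF ext_ideal_mult_right[of "u - u'" sA v] ext_ideal_mult_left[of "v - v'" sA u']]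
  by (simp add: algebra_simps)

lemma ext_eq_sum: "(\<And>i. i \<in> S \<Longrightarrow> ext_eq sA (h i) (h' i)) \<Longrightarrow> ext_eq sA (sum h S) (sum h' S)"
  by (induction S rule: infinite_finite_induct) (auto intro: ext_eq_add)

section \<open>Calculus of generators modulo the relations\<close>

lemma gen_add: "ext_eq sA (gen (x + y)) (gen x + gen y)"
proof -
  have "gen (x + y) - gen x - gen y \<in> ext_relations sA"
    unfolding ext_relations_alt by blast
  then show ?thesis
    using ext_relations_in_ideal[of sA] by (auto simp: ext_eq_def diff_diff_eq)
qed

lemma gen_scale: "ext_eq sA (gen (sA a x)) (scal a * gen x)"
proof -
  have "gen (sA a x) - scal a * gen x \<in> ext_relations sA"
    unfolding ext_relations_alt by blast
  then show ?thesis
    using ext_relations_in_ideal[of sA] by (auto simp: ext_eq_def)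
qed

lemma gen_square: "gen x * gen x \<in> ext_ideal sA"
proof -
  have "gen x * gen x \<in> ext_relations sA"
    unfolding ext_relations_alt by blast
  then show ?thesis using ext_relations_in_ideal[of sA] by auto
qed

lemmas ext_ideal_closed = ext_ideal_zero ext_ideal_add ext_ideal_uminus ext_ideal_diff
  ext_ideal_mult_left ext_ideal_mult_right

text \<open>The additivity relation at \<open>x = y = 0\<close> reduces to
  \<open>- gen 0\<close>.\<close>

lemma gen_0: "gen 0 \<in> ext_ideal sA"
  using ext_ideal_uminus[OF gen_add[of sA 0 0, unfolded ext_eq_def]] by simp

lemma gen_uminus: "ext_eq sA (gen (- x)) (- gen x)"
proof (rule ext_eqI)
  show "gen (- x) - - gen x = gen 0 - (gen (x + - x) - (gen x + gen (- x)))" by simp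
  show "gen 0 - (gen (x + - x) - (gen x + gen (- x))) \<in> ext_ideal sA"
    by (intro ext_ideal_diff gen_0 gen_add[unfolded ext_eq_def])
qed

text \<open>Polarisation of the squares: the first three terms of \<open>?e\<close> add up to the
  square of \<open>gen x + gen y\<close>, and every term of \<open>?e\<close> lies in the
  ideal.\<close>

lemma gen_anticommute: "ext_eq sA (gen x * gen y) (- (gen y * gen x))"
proof (rule ext_eqI)
  let ?d = "gen (x + y) - (gen x + gen y)"
  let ?e = "gen (x + y) * gen (x + y) - ?d * gen (x + y) - (gen x + gen y) * ?d
    - gen x * gen x - gen y * gen y"
  show "gen x * gen y - - (gen y * gen x) = ?e" by (simp add: algebra_simps)
  show "?e \<in> ext_ideal sA"
    by (intro ext_ideal_diff gen_square ext_ideal_mult_right[OF gen_add[unfolded ext_eq_def]]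
        ext_ideal_mult_left[OF gen_add[unfolded ext_eq_def]])
qed

text \<open>
  The hypotheses on \<open>f\<close> and \<open>k\<close> are what is needed for \<open>D p\<close> to preserve the ideal of relations.
  Members of the family are intertwined by \<open>\<sigma>\<close>, which absorbs the Koszul sign of moving the
  operator past a generator; thus one notion covers even and odd derivations.
\<close>

locale twisted_derivation =
  fixes sA :: "'a::comm_ring_1 \<Rightarrow> 'g::ab_group_add \<Rightarrow> 'g"
    and \<sigma> :: "'p \<Rightarrow> 'p" and f :: "'p \<Rightarrow> 'a \<Rightarrow> ('g, 'a) free_alg"
    and k :: "'p \<Rightarrow> 'g \<Rightarrow> ('g, 'a) free_alg"
    and D :: "'p \<Rightarrow> ('g, 'a) free_alg \<Rightarrow> ('g, 'a) free_alg"
  assumes D_add: "D p (u + v) = D p u + D p v"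
    and D_scal: "D p (scal a) = f p a"
    and D_gen: "D p (gen x * u) = k p x * u + gen x * D (\<sigma> p) u"
    and f_mult: "ext_eq sA (f p (a * b)) (f p a * scal b + scal a * f p b)"
    and f_gen: "ext_eq sA (gen x * f (\<sigma> p) a) (f p a * gen x)"
    and k_add: "ext_eq sA (k p (x + y)) (k p x + k p y)"
    and k_scale: "ext_eq sA (k p (sA a x)) (f p a * gen x + scal a * k p x)"
    and k_square: "k p x * gen x + gen x * k (\<sigma> p) x \<in> ext_ideal sA"
begin

lemma D_0: "D p 0 = 0"
  using D_add[of p 0 0] by simp

lemma D_uminus: "D p (- u) = - D p u"
  using D_add[of p u "- u"] by (simp add: D_0 add_eq_0_iff)

lemma D_diff: "D p (u - v) = D p u - D p v"
  using D_add[of p u "- v"] by (simp add: D_uminus)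

text \<open>\<open>D_scal\<close> evaluates a coefficient only after all letters. For a coefficient
  in front, \<open>f_gen\<close> carries its derivative past the letters, at the price of equality
  only modulo the relations.\<close>

lemma D_scal_mult: "ext_eq sA (D p (scal b * u)) (f p b * u + scal b * D p u)"
proof (induction u arbitrary: p rule: free_alg_induct)
  case (scal a)
  then show ?case by (simp add: scal_mult[symmetric] D_scal f_mult)
next
  case (gen x u)
  show ?case
  proof (rule ext_eqI)
    show "D p (scal b * (gen x * u)) - (f p b * (gen x * u) + scal b * D p (gen x * u))
      = gen x * (D (\<sigma> p) (scal b * u) - (f (\<sigma> p) b * u + scal b * D (\<sigma> p) u))
        + (gen x * f (\<sigma> p) b - f p b * gen x) * u"
      \<comment> \<open>The first call moves \<open>scal b\<close> behind \<open>gen x\<close>, so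
        that \<open>D_gen\<close> applies.\<close>
      by (simp add: move_scal(2)[of _ "gen x", symmetric] D_gen)
        (simp add: move_scal algebra_simps)
    show "\<dots> \<in> ext_ideal sA"
      by (intro ext_ideal_closed(2) ext_ideal_mult_left ext_ideal_mult_right[of "_ - _"]
          gen[unfolded ext_eq_def] f_gen[unfolded ext_eq_def])
  qed
next
  case (add u v)
  then show ?case
    using ext_eq_add[OF add(1)[of p] add(2)[of p]] by (simp add: D_add distrib_left algebra_simps)
qed

text \<open>On each kind of relation, the hypotheses on \<open>f\<close> and \<open>k\<close> keep
  \<open>D\<close> inside the ideal. Right factors are carried along as \<open>t\<close>, because
  \<open>D_gen\<close> peels letters from the left only.\<close>

lemma D_ideal:
  assumes "u \<in> ext_ideal sA"
  shows "D p u \<in> ext_ideal sA"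
proof -
  have rel: "D p (u * t) \<in> ext_ideal sA" if u: "u \<in> ext_relations sA" for u t p
  proof -
    \<comment> \<open>In the first and third case \<open>e\<close> is the relation itself and
      \<open>q\<close> the parameter reached after its letters.\<close>
    have comb: "D p (u * t) \<in> ext_ideal sA"
      if "D p (u * t) = d * t + e * D q t" "d \<in> ext_ideal sA" "e \<in> ext_ideal sA" for d e q
      unfolding that(1) by (intro ext_ideal_add ext_ideal_mult_right that)
    consider x y where "u = gen (x + y) - gen x - gen y" | a x where "u = gen (sA a x) - scal a * gen x"
      | x where "u = gen x * gen x"
      using u unfolding ext_relations_alt by blast
    then show ?thesis
    proof cases
      case 1
      show ?thesis
      proof (rule comb)
        show "D p (u * t) = (k p (x + y) - (k p x + k p y)) * t
            + (gen (x + y) - (gen x + gen y)) * D (\<sigma> p) t"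
          by (simp add: 1 left_diff_distrib D_diff D_add D_gen algebra_simps)
      qed (rule k_add[unfolded ext_eq_def] gen_add[unfolded ext_eq_def])+
    next
      case 2
      \<comment> \<open>Here a scalar precedes a generator, so the error of
        \<open>D_scal_mult\<close> enters as a further summand in the ideal.\<close>
      have "D p (u * t) = (k p (sA a x) - (f p a * gen x + scal a * k p x)) * t
            + (gen (sA a x) - scal a * gen x) * D (\<sigma> p) t
            - (D p (scal a * (gen x * t)) - (f p a * (gen x * t) + scal a * D p (gen x * t)))"
        by (simp add: 2 left_diff_distrib D_diff D_gen algebra_simps)
      then show ?thesis
        using k_scale[unfolded ext_eq_def] gen_scale[unfolded ext_eq_def]
          D_scal_mult[unfolded ext_eq_def]
        by (metis ext_ideal_closed)
    next
      case 3
      show ?thesis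
      proof (rule comb)
        show "D p (u * t) = (k p x * gen x + gen x * k (\<sigma> p) x) * t
            + gen x * gen x * D (\<sigma> (\<sigma> p)) t"
          by (simp add: 3 mult.assoc D_gen algebra_simps)
      qed (rule k_square gen_square)+
    qed
  qed
  \<comment> \<open>All parameters are needed in the hypothesis, since passing a letter of
    \<open>s\<close> changes \<open>p\<close> to \<open>\<sigma> p\<close>.\<close>
  have left: "D p (s * v) \<in> ext_ideal sA"
    if "v \<in> ext_ideal sA" "\<And>p. D p v \<in> ext_ideal sA" for s v p
  proof (induction s arbitrary: p rule: free_alg_induct)
    case (scal a)
    have "D p (scal a * v) = (D p (scal a * v) - (f p a * v + scal a * D p v))
        + (f p a * v + scal a * D p v)"
      by simp
    also have "\<dots> \<in> ext_ideal sA"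
      by (intro ext_ideal_add ext_ideal_mult_left that D_scal_mult[unfolded ext_eq_def])
    finally show ?case .
  next
    case (gen x u)
    then show ?case
      by (simp add: mult.assoc D_gen) (intro ext_ideal_add ext_ideal_mult_left that gen)
  next
    case (add u v)
    then show ?case by (simp add: distrib_right D_add ext_ideal_add)
  qed
  \<comment> \<open>The factor \<open>t\<close> strengthens the induction so that right multiples
    are absorbed into it; \<open>t = 1\<close> gives the claim.\<close>
  have "\<forall>t p. u * t \<in> ext_ideal sA \<and> D p (u * t) \<in> ext_ideal sA"
    using assms
  proof (induction u rule: ext_ideal_induct)
    case (relation u)
    then show ?case using rel ext_relations_in_ideal by (blast intro: ext_ideal_mult_right)
  next
    case (mult_left s u)
    then show ?case by (simp add: mult.assoc ext_ideal_mult_left left)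
  qed (simp_all add: D_0 D_add distrib_right mult.assoc ext_ideal_zero ext_ideal_add)
  from this[rule_format, of 1 p] show ?thesis by simp
qed

end

section \<open>The parity involution\<close>

text \<open>The parameter carries the sign \<open>(-1)\<^sup>n\<close> accumulated over \<open>n\<close> letters.\<close>

definition parity :: "('g, 'a::comm_ring_1) free_alg \<Rightarrow> ('g, 'a) free_alg"
  where "parity = free_rec uminus (\<lambda>s a. scal (s * a)) (\<lambda>_ _. 0) 1"

lemma parity_add: "parity (u + v) = parity u + parity v"
  unfolding parity_def by (rule free_rec_add) (simp add: distrib_left scal_add)

lemma parity_scal [simp]: "parity (scal a) = scal a"
  unfolding parity_def by (subst free_rec_scal) (simp_all add: distrib_left scal_add)

lemma parity_gen_mult [simp]: "parity (gen x * u) = - (gen x * parity u)"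
proof -
  \<comment> \<open>With the sign kept as a parameter, \<open>E (- s) u = - E s u\<close> can be
    proved by induction; it turns the parameter shift of the recursion into a sign.\<close>
  define E where "E = free_rec uminus (\<lambda>s a :: 'b. scal (s * a)) (\<lambda>_ (_ :: 'a). 0)"
  note rules = free_rec_add free_rec_scal free_rec_gen
  have [simp]: "E s (u + v) = E s u + E s v" "E s (scal a) = scal (s * a)"
    "E s (gen x * u) = gen x * E (- s) u" for s u v x a
    unfolding E_def by (subst rules; simp add: distrib_left scal_add)+
  have "E (- s) u = - E s u" for s
    by (induction u arbitrary: s rule: free_alg_induct) (simp_all add: scal_minus)
  from this[of 1] show ?thesis
    by (simp add: parity_def E_def[symmetric])
qed

lemma parity_0 [simp]: "parity 0 = 0" and parity_1 [simp]: "parity 1 = 1"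
  using parity_scal[of 0] parity_scal[of 1] by simp_all

lemma parity_gen [simp]: "parity (gen x) = - gen x"
  using parity_gen_mult[of x 1] by simp

lemma parity_uminus [simp]: "parity (- u) = - parity u"
  using parity_add[of u "- u"] by (simp add: add_eq_0_iff)

lemma parity_diff: "parity (u - v) = parity u - parity v"
  using parity_add[of u "- v"] by simp

lemma parity_parity [simp]: "parity (parity u) = u"
  by (induction u rule: free_alg_induct) (simp_all add: parity_add)

lemma parity_scal_mult [simp]: "parity (scal a * u) = scal a * parity u"
  by (induction u rule: free_alg_induct)
    (simp_all add: parity_add distrib_left move_scal(2)[symmetric] scal_mult[symmetric])

lemma parity_mult: "parity (u * v) = parity u * parity v"
  by (induction u rule: free_alg_induct) (simp_all add: parity_add distrib_right mult.assoc)

lemma parity_word: "parity (word xs) = scal ((- 1) ^ length xs) * word xs"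
  by (induction xs) (simp_all add: word_Cons scal_minus move_scal)

text \<open>Every letter crossed costs a sign. Applying \<open>parity\<close> to \<open>u\<close>
  collects these signs even for inhomogeneous \<open>u\<close>.\<close>

lemma gen_graded_commute: "ext_eq sA (gen x * u) (parity u * gen x)"
proof (induction u rule: free_alg_induct)
  case (scal a)
  then show ?case by (simp add: scal_commute)
next
  case (gen y u)
  have "gen x * (gen y * u) = (gen x * gen y) * u" by (simp add: mult.assoc)
  also have "ext_eq sA \<dots> (- (gen y * gen x) * u)"
    by (intro ext_eq_refl gen_anticommute ext_eq_mult)
  also have "\<dots> = - gen y * (gen x * u)" by (simp add: mult.assoc)
  also have "ext_eq sA \<dots> (- gen y * (parity u * gen x))"
    by (intro ext_eq_mult gen ext_eq_refl)
  finally show ?case by (simp add: mult.assoc)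
next
  case (add u v)
  then show ?case using ext_eq_add[OF add] by (simp add: algebra_simps parity_add)
qed

text \<open>Every relation is homogeneous, so \<open>parity\<close> fixes or negates it.\<close>

lemma parity_ideal:
  assumes "u \<in> ext_ideal sA"
  shows "parity u \<in> ext_ideal sA"
  using assms
proof (induction u rule: ext_ideal_induct)
  case (relation u)
  then have "parity u = u \<or> parity u = - u"
    unfolding ext_relations_alt by (auto simp: parity_diff parity_mult)
  moreover have "u \<in> ext_ideal sA" using relation ext_relations_in_ideal by blast
  ultimately show ?case by (auto intro: ext_ideal_uminus)
qed (auto simp: parity_add parity_mult intro: ext_ideal_closed)

lemma even_commute:
  assumes "parity v = v"
  shows "ext_eq sA (v * u) (u * v)"
proof (induction u rule: free_alg_induct)
  case (gen y u)
  have *: "ext_eq sA (v * gen y) (gen y * v)"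
    using ext_eq_sym[OF gen_graded_commute[of sA y v]] assms by simp
  have "v * (gen y * u) = (v * gen y) * u" by (simp add: mult.assoc)
  also have "ext_eq sA \<dots> ((gen y * v) * u)"
    by (intro * ext_eq_mult ext_eq_refl)
  also have "\<dots> = gen y * (v * u)" by (simp add: mult.assoc)
  also have "ext_eq sA \<dots> (gen y * (u * v))"
    by (intro ext_eq_mult gen ext_eq_refl)
  finally show ?case by (simp add: mult.assoc)
next
  case (add u w)
  then show ?case using ext_eq_add[OF add] by (simp add: algebra_simps)
qed (simp add: scal_commute)

lemma odd_commute:
  assumes "parity v = - v"
  shows "ext_eq sA (v * u) (parity u * v)"
proof (induction u rule: free_alg_induct)
  case (gen y u)
  have *: "ext_eq sA (v * gen y) (- (gen y * v))"
    using ext_eq_sym[OF ext_eq_uminus[OF gen_graded_commute[of sA y v]]] assms by simp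
  have "v * (gen y * u) = (v * gen y) * u" by (simp add: mult.assoc)
  also have "ext_eq sA \<dots> (- (gen y * v) * u)"
    by (intro * ext_eq_mult ext_eq_refl)
  also have "\<dots> = - gen y * (v * u)" by (simp add: mult.assoc)
  also have "ext_eq sA \<dots> (- gen y * (parity u * v))"
    by (intro ext_eq_mult gen ext_eq_refl)
  finally show ?case by (simp add: mult.assoc)
next
  case (add u w)
  then show ?case using ext_eq_add[OF add] by (simp add: algebra_simps parity_add)
qed (simp add: scal_commute)

lemma omit_0 [simp]: "omit 0 (x # xs) = xs" and omit_Suc [simp]: "omit (Suc i) (x # xs) = x # omit i xs"
  by (simp_all add: omit_def)

lemma length_omit: "i < length xs \<Longrightarrow> length xs = Suc (length (omit i xs))"
  by (simp add: omit_def)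

section \<open>The bracket on the free algebra\<close>

context lie_rinehart
begin

abbreviation cong_ext (infix "\<asymp>" 50)
  where "u \<asymp> v \<equiv> ext_eq sA u v"

lemma br_add_right: "br x (y + z) = br x y + br x z"
  using br_linear_right[of x] by (simp add: Vector_Spaces.linear_def module_hom_def module_hom_axioms_def)

lemma br_add_left: "br (x + y) z = br x z + br y z"
  using br_linear_left[of z] by (simp add: Vector_Spaces.linear_def module_hom_def module_hom_axioms_def)

text \<open>Polarisation of \<open>br_self\<close> at \<open>x + y\<close>.\<close>

lemma br_anti: "br x y = - br y x"
proof -
  have "br (x + y) (x + y) = br x x + br y y + (br x y + br y x)"
    by (simp only: br_add_left br_add_right add.assoc add.left_commute add.commute)
  then show ?thesis by (simp add: br_self eq_neg_iff_add_eq_0)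
qed

lemma br_minus_right: "br x (- y) = - br x y"
  using br_add_right[of x 0 0] br_add_right[of x y "- y"] by (simp add: add_eq_0_iff)

lemma br_scale_left: "br (sA a x) y = sA a (br x y) - sA (\<rho> y a) x"
  by (subst (1 2) br_anti) (simp add: br_leibniz)

lemma anchor_add_right: "\<rho> x (a + b) = \<rho> x a + \<rho> x b"
  and anchor_mult: "\<rho> x (a * b) = a * \<rho> x b + b * \<rho> x a"
  and anchor_scaleK: "\<rho> x (sK c a) = sK c (\<rho> x a)"
  using anchor_derivation[of x] by (simp_all add: mult.commute derivations_def Vector_Spaces.linear_def module_hom_def module_hom_axioms_def)

lemma anchor_1 [simp]: "\<rho> x 1 = 0"
  using anchor_mult[of x 1 1] by simp

lemma anchor_minus: "\<rho> x (- a) = - \<rho> x a"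
  using anchor_add_right[of x 0 0] anchor_add_right[of x a "- a"] by (simp add: add_eq_0_iff)

section \<open>The Lie derivative\<close>

definition Lie :: "'g \<Rightarrow> ('g, 'a) free_alg \<Rightarrow> ('g, 'a) free_alg"
  where "Lie = free_rec id (\<lambda>y a. scal (\<rho> y a)) (\<lambda>y x. gen (br y x))"

lemma Lie_add: "Lie y (u + v) = Lie y u + Lie y v"
  and Lie_scal [simp]: "Lie y (scal a) = scal (\<rho> y a)"
  and Lie_gen_mult: "Lie y (gen x * u) = gen (br y x) * u + gen x * Lie y u"
  unfolding Lie_def by (subst free_rec_add free_rec_scal free_rec_gen; simp add: anchor_add_right scal_add)+

text \<open>\<open>Lie y\<close> has degree 0, so no signs arise and \<open>\<sigma>\<close> is the
  identity. The Leibniz rule of the bracket is exactly \<open>k_scale\<close>; anticommuting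
  generators give \<open>k_square\<close>.\<close>

interpretation Lie: twisted_derivation sA id "\<lambda>y a. scal (\<rho> y a)" "\<lambda>y x. gen (br y x)" Lie
proof
  fix y x x' :: 'g and a b :: 'a
  show "scal (\<rho> y (a * b)) \<asymp> scal (\<rho> y a) * scal b + scal a * scal (\<rho> y b)"
    by (simp add: anchor_mult scal_add scal_mult scal_ac add.commute)
  show "gen x * scal (\<rho> (id y) a) \<asymp> scal (\<rho> y a) * gen x"
    by (simp add: scal_commute)
  show "gen (br y (x + x')) \<asymp> gen (br y x) + gen (br y x')"
    by (simp add: br_add_right gen_add)
  have "gen (br y (sA a x)) \<asymp> gen (sA (\<rho> y a) x) + gen (sA a (br y x))"
    by (simp add: br_leibniz gen_add add.commute[of "sA a _"])
  also have "\<dots> \<asymp> scal (\<rho> y a) * gen x + scal a * gen (br y x)"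
    by (intro ext_eq_add gen_scale)
  finally show "gen (br y (sA a x)) \<asymp> scal (\<rho> y a) * gen x + scal a * gen (br y x)" .
  show "gen (br y x) * gen x + gen x * gen (br (id y) x) \<in> ext_ideal sA"
    using gen_anticommute[of sA "br y x" x] by (simp add: ext_eq_def)
qed (simp_all add: Lie_add Lie_gen_mult)

lemmas Lie_0 [simp] = Lie.D_0
lemmas Lie_uminus [simp] = Lie.D_uminus
lemmas Lie_diff = Lie.D_diff

lemma Lie_gen: "Lie y (gen x) = gen (br y x)"
  using Lie_gen_mult[of y x 1] Lie_scal[of y 1] by simp

text \<open>Unlike \<open>D_scal_mult\<close> this is an equality in the free algebra:
  \<open>scal (\<rho> y a)\<close> commutes with every letter.\<close>

lemma Lie_scal_mult: "Lie y (scal a * u) = scal (\<rho> y a) * u + scal a * Lie y u"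
  by (induction u rule: free_alg_induct)
    (simp_all add: Lie_add distrib_left move_scal(2)[of _ "gen _", symmetric] Lie_gen_mult,
     simp_all add: scal_mult[symmetric] scal_add[symmetric] anchor_mult move_scal algebra_simps)

lemma Lie_mult: "Lie y (u * v) = Lie y u * v + u * Lie y v"
  by (induction u rule: free_alg_induct)
    (simp_all add: Lie_add Lie_scal_mult Lie_gen_mult mult.assoc algebra_simps)

lemma parity_Lie: "parity (Lie y u) = Lie y (parity u)"
  by (induction u rule: free_alg_induct) (simp_all add: Lie_add parity_add Lie_gen_mult)

lemma Lie_index_add: "Lie (x + y) u \<asymp> Lie x u + Lie y u"
proof (induction u rule: free_alg_induct)
  case (scal a)
  then show ?case by (simp add: anchor_add scal_add)
next
  case (gen z u)
  have "Lie (x + y) (gen z * u) = gen (br x z + br y z) * u + gen z * Lie (x + y) u"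
    by (simp add: Lie_gen_mult br_add_left)
  also have "\<dots> \<asymp> (gen (br x z) + gen (br y z)) * u + gen z * (Lie x u + Lie y u)"
    by (intro ext_eq_refl gen gen_add ext_eq_mult ext_eq_add)
  also have "\<dots> = Lie x (gen z * u) + Lie y (gen z * u)"
    by (simp add: Lie_gen_mult algebra_simps)
  finally show ?case .
next
  case (add u v)
  then show ?case using ext_eq_add[OF add] by (simp add: algebra_simps Lie_add)
qed

text \<open>On scalars this is \<open>anchor_br\<close>, on letters the Jacobi identity of
  \<open>br\<close>; the mixed terms cancel in the commutator.\<close>

lemma Lie_commutator: "Lie y (Lie z u) - Lie z (Lie y u) \<asymp> Lie (br y z) u"
proof (induction u rule: free_alg_induct)
  case (scal a)
  then show ?case by (simp add: anchor_br scal_diff)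
next
  case (gen x u)
  have "br y (br z x) - br z (br y x) = br (br y z) x"
    using br_jacobi[of y z x] br_anti[of x "br y z"]
    by (simp add: br_anti[of x y] br_minus_right algebra_simps)
  then have "gen (br (br y z) x) = gen (br y (br z x) + - br z (br y x))" by simp
  also have "\<dots> \<asymp> gen (br y (br z x)) + - gen (br z (br y x))"
    by (rule ext_eq_trans[OF gen_add ext_eq_add[OF ext_eq_refl gen_uminus]])
  finally have *: "gen (br y (br z x)) - gen (br z (br y x)) \<asymp> gen (br (br y z) x)"
    by (simp add: ext_eq_sym)
  have "Lie y (Lie z (gen x * u)) - Lie z (Lie y (gen x * u))
      = (gen (br y (br z x)) - gen (br z (br y x))) * u + gen x * (Lie y (Lie z u) - Lie z (Lie y u))"
    by (simp add: Lie_gen_mult Lie_add algebra_simps)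
  also have "\<dots> \<asymp> gen (br (br y z) x) * u + gen x * Lie (br y z) u"
    by (intro ext_eq_refl gen * ext_eq_mult ext_eq_add)
  finally show ?case by (simp add: Lie_gen_mult)
next
  case (add u v)
  then show ?case using ext_eq_add[OF add] by (simp add: algebra_simps Lie_add)
qed

section \<open>Contraction with differentials\<close>

text \<open>
  Left and right contraction with \<open>da\<close>; the right one is \<open>[-, a]\<close>. The Koszul sign of the left one
  comes from negating the parameter.
\<close>

definition contract :: "'a \<Rightarrow> ('g, 'a) free_alg \<Rightarrow> ('g, 'a) free_alg"
  where "contract = free_rec uminus (\<lambda>_ _. 0) (\<lambda>a x. scal (\<rho> x a))"

lemma contract_add: "contract a (u + v) = contract a u + contract a v"
  and contract_scal [simp]: "contract a (scal b) = 0"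
  and contract_gen_mult': "contract a (gen x * u) = scal (\<rho> x a) * u + gen x * contract (- a) u"
  unfolding contract_def by (subst free_rec_add free_rec_scal free_rec_gen; simp)+

lemma contract_minus_index: "contract (- a) u = - contract a u"
  by (induction u arbitrary: a rule: free_alg_induct)
    (simp_all add: contract_add contract_gen_mult' anchor_minus scal_minus)

lemma contract_gen_mult: "contract a (gen x * u) = scal (\<rho> x a) * u - gen x * contract a u"
  by (simp add: contract_gen_mult' contract_minus_index)

interpretation contract: twisted_derivation sA uminus "\<lambda>_ _. 0" "\<lambda>a x. scal (\<rho> x a)" contract
  by standard (simp_all add: contract_add contract_gen_mult' anchor_add scal_add anchor_scale
      scal_mult anchor_minus scal_minus move_scal ext_ideal_zero)

lemmas contract_0 [simp] = contract.D_0
lemmas contract_uminus [simp] = contract.D_uminus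

definition rcontract :: "'a \<Rightarrow> ('g, 'a) free_alg \<Rightarrow> ('g, 'a) free_alg"
  where "rcontract a u = - contract a (parity u)"

lemma rcontract_add: "rcontract a (u + v) = rcontract a u + rcontract a v"
  and rcontract_0 [simp]: "rcontract a 0 = 0"
  and rcontract_uminus [simp]: "rcontract a (- u) = - rcontract a u"
  and rcontract_scal [simp]: "rcontract a (scal b) = 0"
  and rcontract_gen_mult: "rcontract a (gen x * u) = scal (\<rho> x a) * parity u + gen x * rcontract a u"
  by (simp_all add: rcontract_def contract_add parity_add contract_gen_mult)

lemma rcontract_diff: "rcontract a (u - v) = rcontract a u - rcontract a v"
  using rcontract_add[of a u "- v"] by simp

lemma rcontract_gen [simp]: "rcontract a (gen x) = scal (\<rho> x a)"
  using rcontract_gen_mult[of a x 1] rcontract_scal[of a 1] by simp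

lemma rcontract_ideal: "u \<in> ext_ideal sA \<Longrightarrow> rcontract a u \<in> ext_ideal sA"
  unfolding rcontract_def by (intro ext_ideal_uminus contract.D_ideal parity_ideal)

lemma rcontract_index_add: "rcontract (a + b) u = rcontract a u + rcontract b u"
  by (induction u rule: free_alg_induct)
    (simp_all add: rcontract_add rcontract_gen_mult anchor_add_right scal_add algebra_simps)

text \<open>Contraction is with \<open>da\<close>, and \<open>d(ab) = a db + b da\<close>.\<close>

lemma rcontract_index_mult: "rcontract (a * b) u = scal a * rcontract b u + scal b * rcontract a u"
  by (induction u rule: free_alg_induct)
    (simp_all add: rcontract_add rcontract_gen_mult anchor_mult scal_add scal_mult scal_ac
      algebra_simps move_scal)

lemma rcontract_scal_mult: "rcontract a (scal b * u) = scal b * rcontract a u"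
  by (induction u rule: free_alg_induct)
    (simp_all add: rcontract_add distrib_left move_scal(2)[of _ "gen _", symmetric] rcontract_gen_mult
       scal_mult[symmetric], simp add: scal_mult mult.assoc scal_ac move_scal)

text \<open>The operator acts from the right, so it must cross \<open>v\<close> to reach
  \<open>u\<close>; hence the sign on \<open>v\<close>.\<close>

lemma rcontract_mult: "rcontract a (u * v) = u * rcontract a v + rcontract a u * parity v"
  by (induction u rule: free_alg_induct)
    (simp_all add: rcontract_add rcontract_gen_mult rcontract_scal_mult parity_mult algebra_simps mult.assoc)

lemma parity_rcontract: "parity (rcontract a u) = - rcontract a (parity u)"
  by (induction u rule: free_alg_induct) (simp_all add: rcontract_add parity_add rcontract_gen_mult)

lemma rcontract_anticommute: "rcontract a (rcontract b u) = - rcontract b (rcontract a u)"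
  by (induction u rule: free_alg_induct)
   (simp_all add: rcontract_add rcontract_gen_mult rcontract_scal_mult parity_rcontract algebra_simps)

text \<open>Cartan's commutation rule for the Lie derivative and contraction with \<open>da\<close>;
  on a letter it comes down to \<open>anchor_br\<close>.\<close>

lemma Lie_rcontract: "Lie y (rcontract a u) = rcontract a (Lie y u) + rcontract (\<rho> y a) u"
  by (induction u rule: free_alg_induct)
    (simp_all add: rcontract_add Lie_add rcontract_gen_mult Lie_gen_mult Lie_scal_mult parity_Lie anchor_br
     scal_diff algebra_simps)

text \<open>The bracket is not \<open>A\<close>-linear in its first argument, by
  \<open>br_scale_left\<close>. The resulting correction term is what lets \<open>sn\<close> respect
  the relation for \<open>sA a x\<close>.\<close>

lemma Lie_index_scale: "Lie (sA a x) u \<asymp> scal a * Lie x u - rcontract a u * gen x"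
proof (induction u rule: free_alg_induct)
  case (scal b)
  then show ?case by (simp add: anchor_scale scal_mult)
next
  case (gen y u)
  have "gen (br (sA a x) y) = gen (sA a (br x y) + sA (- \<rho> y a) x)"
    by (simp add: br_scale_left)
  also have "\<dots> \<asymp> gen (sA a (br x y)) + gen (sA (- \<rho> y a) x)" by (rule gen_add)
  also have "\<dots> \<asymp> scal a * gen (br x y) + scal (- \<rho> y a) * gen x"
    by (intro ext_eq_add gen_scale)
  finally have *: "gen (br (sA a x) y) \<asymp> scal a * gen (br x y) - scal (\<rho> y a) * gen x"
    by (simp add: scal_minus)
  have "Lie (sA a x) (gen y * u) = gen (br (sA a x) y) * u + gen y * Lie (sA a x) u"
    by (simp add: Lie_gen_mult)
  also have "\<dots> \<asymp> (scal a * gen (br x y) - scal (\<rho> y a) * gen x) * u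
      + gen y * (scal a * Lie x u - rcontract a u * gen x)"
    by (intro ext_eq_refl gen * ext_eq_mult ext_eq_add)
  \<comment> \<open>The last term is isolated because its \<open>gen x\<close> has to move across
    \<open>u\<close> to the right end.\<close>
  also have "\<dots> = scal a * gen (br x y) * u + gen y * (scal a * Lie x u - rcontract a u * gen x)
      - scal (\<rho> y a) * (gen x * u)"
    by (simp add: algebra_simps)
  also have "\<dots> \<asymp> scal a * gen (br x y) * u + gen y * (scal a * Lie x u - rcontract a u * gen x)
      - scal (\<rho> y a) * (parity u * gen x)"
    by (intro ext_eq_refl ext_eq_mult ext_eq_diff gen_graded_commute)
  also have "\<dots> = scal a * Lie x (gen y * u) - rcontract a (gen y * u) * gen x"
    by (simp add: Lie_gen_mult rcontract_gen_mult algebra_simps move_scal)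
  finally show ?case .
next
  case (add u v)
  then show ?case using ext_eq_add[OF add] by (simp add: algebra_simps Lie_add rcontract_add)
qed

section \<open>The bracket by recursion in its second argument\<close>

text \<open>
  \<open>sn P\<close> is the derivation of degree \<open>p - 1\<close> determined by its values \<open>[P, a]\<close> on \<open>A\<close> and
  \<open>[P, y] = - L\<^sub>y P\<close> on \<open>G\<close>. Twisting by \<open>- parity P = (-1)\<^bsup>p-1\<^esup> P\<close> keeps the formula additive in \<open>P\<close>,
  so that \<open>P\<close> need not be homogeneous.
\<close>

definition sn :: "('g, 'a) free_alg \<Rightarrow> ('g, 'a) free_alg \<Rightarrow> ('g, 'a) free_alg"
  where "sn = free_rec (\<lambda>P. - parity P) (\<lambda>P a. rcontract a P) (\<lambda>P y. - Lie y P)"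

lemma sn_add: "sn P (u + v) = sn P u + sn P v"
  and sn_scal [simp]: "sn P (scal a) = rcontract a P"
  and sn_gen_mult: "sn P (gen y * u) = - Lie y P * u + gen y * sn (- parity P) u"
  unfolding sn_def by (subst free_rec_add free_rec_scal free_rec_gen; simp add: rcontract_index_add)+

interpretation sn: twisted_derivation sA "\<lambda>P. - parity P" "\<lambda>P a. rcontract a P" "\<lambda>P y. - Lie y P" sn
proof
  fix P :: "('g, 'a) free_alg" and x y :: 'g and a b :: 'a
  show "rcontract (a * b) P \<asymp> rcontract a P * scal b + scal a * rcontract b P"
    by (simp add: rcontract_index_mult scal_commute[of "rcontract a P"] add.commute)
  \<comment> \<open>For \<open>P\<close> of degree \<open>p\<close> the contraction has degree
    \<open>p - 1\<close>, and the twist supplies exactly the sign of moving it past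
    \<open>gen x\<close>.\<close>
  show "gen x * rcontract a (- parity P) \<asymp> rcontract a P * gen x"
    using gen_graded_commute[of sA x "rcontract a (- parity P)"] by (simp add: parity_rcontract)
  show "- Lie (x + y) P \<asymp> - Lie x P + - Lie y P"
    using ext_eq_uminus[OF Lie_index_add[of x y P]] by simp
  show "- Lie (sA a x) P \<asymp> rcontract a P * gen x + scal a * - Lie x P"
    using ext_eq_uminus[OF Lie_index_scale[of a x P]] by simp
  show "- Lie x P * gen x + gen x * - Lie x (- parity P) \<in> ext_ideal sA"
    using gen_graded_commute[of sA x "Lie x (parity P)"] by (simp add: parity_Lie ext_eq_def)
qed (simp_all add: sn_add sn_gen_mult)

lemmas sn_0_right [simp] = sn.D_0
lemmas sn_uminus_right [simp] = sn.D_uminus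
lemmas sn_diff_right = sn.D_diff
lemmas sn_scal_mult_right = sn.D_scal_mult
lemmas sn_ideal_right = sn.D_ideal

lemma sn_add_left: "sn (P + P') u = sn P u + sn P' u"
proof (induction u arbitrary: P P' rule: free_alg_induct)
  case (gen x u)
  from gen[of "- parity P" "- parity P'"] show ?case
    by (simp add: sn_gen_mult parity_add Lie_add algebra_simps)
qed (simp_all add: rcontract_add sn_add algebra_simps)

lemma sn_0_left [simp]: "sn 0 u = 0"
  using sn_add_left[of 0 0 u] by simp

lemma sn_uminus_left [simp]: "sn (- P) u = - sn P u"
  using sn_add_left[of P "- P" u] by (simp add: add_eq_0_iff)

lemma sn_diff_left: "sn (P - P') u = sn P u - sn P' u"
  using sn_add_left[of P "- P'" u] by simp

lemma sn_gen_mult_right: "sn P (gen y * u) = - Lie y P * u - gen y * sn (parity P) u"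
  by (simp add: sn_gen_mult)

text \<open>The recursion runs over the second argument; on the first one it applies only
  \<open>rcontract\<close>, \<open>Lie\<close> and \<open>parity\<close>, all of which preserve the
  ideal.\<close>

lemma sn_ideal_left: "P \<in> ext_ideal sA \<Longrightarrow> sn P u \<in> ext_ideal sA"
proof (induction u arbitrary: P rule: free_alg_induct)
  case (scal a)
  then show ?case by (simp add: rcontract_ideal)
next
  case (gen y u)
  then show ?case
    by (simp add: sn_gen_mult_right)
      (intro ext_ideal_diff ext_ideal_uminus ext_ideal_mult_left gen.IH parity_ideal
        ext_ideal_mult_right[of "Lie y P"] Lie.D_ideal)
next
  case (add u v)
  then show ?case by (simp add: sn_add ext_ideal_add)
qed

lemma sn_cong:
  assumes "P \<asymp> P'" "Q \<asymp> Q'"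
  shows "sn P Q \<asymp> sn P' Q'"
proof (rule ext_eqI)
  show "sn P Q - sn P' Q' = sn (P - P') Q + sn P' (Q - Q')"
    by (simp add: sn_diff_left sn_diff_right)
  show "\<dots> \<in> ext_ideal sA"
    using assms unfolding ext_eq_def by (intro ext_ideal_add sn_ideal_left sn_ideal_right)
qed

text \<open>The bracket has degree \<open>p + q - 1\<close>; the \<open>- 1\<close> accounts for the
  sign.\<close>

lemma parity_sn: "parity (sn P Q) = - sn (parity P) (parity Q)"
  by (induction Q arbitrary: P rule: free_alg_induct)
    (simp_all add: sn_add parity_add parity_rcontract sn_gen_mult_right parity_mult parity_diff parity_Lie)

subsection \<open>Compatibility with the Lie derivative and the contraction\<close>

text \<open>The scalar case is \<open>Lie_rcontract\<close>; a letter \<open>z\<close> of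
  \<open>Q\<close> produces the commutator of \<open>Lie y\<close> and \<open>Lie z\<close>.\<close>

lemma Lie_sn: "Lie y (sn P Q) \<asymp> sn (Lie y P) Q + sn P (Lie y Q)"
proof (induction Q arbitrary: P rule: free_alg_induct)
  case (scal a)
  then show ?case by (simp add: Lie_rcontract)
next
  case (gen z u)
  let ?P = "parity P"
  let ?rest = "- Lie z P * Lie y u - gen (br y z) * sn ?P u"
  have "Lie y (sn P (gen z * u)) = - Lie y (Lie z P) * u + ?rest - gen z * Lie y (sn ?P u)"
    by (simp add: sn_gen_mult_right Lie_mult Lie_gen Lie_diff algebra_simps)
  also have "\<dots> \<asymp> - Lie y (Lie z P) * u + ?rest - gen z * (sn (Lie y ?P) u + sn ?P (Lie y u))"
    by (intro ext_eq_refl gen ext_eq_mult ext_eq_diff)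
  \<comment> \<open>\<open>Lie z (Lie y P)\<close> is inserted to form the commutator; it is the
    term needed for \<open>sn (Lie y P)\<close>.\<close>
  also have "\<dots> = - (Lie y (Lie z P) - Lie z (Lie y P)) * u - Lie z (Lie y P) * u + ?rest
      - gen z * (sn (Lie y ?P) u + sn ?P (Lie y u))"
    by (simp add: algebra_simps)
  also have "\<dots> \<asymp> - Lie (br y z) P * u - Lie z (Lie y P) * u + ?rest
      - gen z * (sn (Lie y ?P) u + sn ?P (Lie y u))"
    by (intro ext_eq_refl Lie_commutator ext_eq_mult ext_eq_diff ext_eq_uminus ext_eq_add)
  also have "\<dots> = sn (Lie y P) (gen z * u) + sn P (Lie y (gen z * u))"
    by (simp add: sn_gen_mult_right sn_add Lie_gen_mult parity_Lie algebra_simps)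
  finally show ?case .
next
  case (add u v)
  then show ?case using ext_eq_add[OF add] by (simp add: algebra_simps Lie_add sn_add)
qed

text \<open>The scalar case says that contractions anticommute; a letter of \<open>Q\<close> leads
  to \<open>Lie_rcontract\<close>.\<close>

lemma rcontract_sn: "rcontract a (sn P Q) \<asymp> sn P (rcontract a Q) - sn (rcontract a P) (parity Q)"
proof (induction Q arbitrary: P rule: free_alg_induct)
  case (scal b)
  show ?case by (simp, subst rcontract_anticommute, simp)
next
  case (gen z u)
  let ?P = "parity P" and ?b = "\<rho> z a"
  let ?rest = "- Lie z P * rcontract a u - rcontract a (Lie z P) * parity u"
  let ?tail = "gen z * (sn ?P (rcontract a u) - sn (rcontract a ?P) (parity u))"
  have "rcontract a (sn P (gen z * u))
      = ?rest + scal ?b * sn P (parity u) - gen z * rcontract a (sn ?P u)"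
    by (simp add: sn_gen_mult_right rcontract_add rcontract_mult rcontract_gen_mult parity_sn
        rcontract_diff algebra_simps)
  also have "\<dots> \<asymp> ?rest + scal ?b * sn P (parity u) - ?tail"
    by (intro ext_eq_refl gen ext_eq_mult ext_eq_diff)
  \<comment> \<open>Adding and subtracting \<open>rcontract ?b P * parity u\<close> completes the
    Leibniz rule for \<open>sn P\<close> on \<open>scal ?b * parity u\<close>.\<close>
  also have "\<dots> = ?rest - rcontract ?b P * parity u
      + (rcontract ?b P * parity u + scal ?b * sn P (parity u)) - ?tail"
    by (simp add: algebra_simps)
  also have "\<dots> \<asymp> ?rest - rcontract ?b P * parity u + sn P (scal ?b * parity u) - ?tail"
    by (intro ext_eq_refl ext_eq_sym[OF sn_scal_mult_right] ext_eq_diff ext_eq_add)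
  also have "\<dots> = sn P (rcontract a (gen z * u)) - sn (rcontract a P) (parity (gen z * u))"
    by (simp add: sn_gen_mult_right sn_add rcontract_gen_mult Lie_rcontract parity_rcontract algebra_simps)
  finally show ?case .
next
  case (add u v)
  then show ?case using ext_eq_add[OF add] by (simp add: algebra_simps rcontract_add parity_add sn_add)
qed

subsection \<open>Antisymmetry\<close>

lemma sn_scal_left: "sn (scal a) P = - contract a P"
  by (induction P rule: free_alg_induct)
    (simp_all add: sn_gen_mult_right contract_gen_mult sn_add contract_add)

lemma gen_br_anti: "- gen (br x y) \<asymp> gen (br y x)"
  using ext_eq_sym[OF gen_uminus[of sA "br x y"]] by (simp add: br_anti[of y x])

text \<open>The counterpart of the defining recursion in the first argument, on which antisymmetry
  rests. \<open>U\<close> is arbitrary because the recursion on \<open>R\<close> replaces it by its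
  parity.\<close>

lemma sn_gen_mult_left: "sn (gen y * U) R \<asymp> gen y * sn U R + parity U * Lie y R"
proof (induction R arbitrary: U rule: free_alg_induct)
  case (scal b)
  then show ?case by (simp add: rcontract_gen_mult scal_commute[of "parity U"] add.commute)
next
  case (gen z v)
  let ?U = "parity U"
  have "sn (gen y * U) (gen z * v)
      = (- gen (br z y) * U) * v - gen y * Lie z U * v + gen z * sn (gen y * ?U) v"
    by (simp add: sn_gen_mult_right Lie_gen_mult algebra_simps)
  also have "\<dots> \<asymp> (gen (br y z) * U) * v - gen y * Lie z U * v
      + gen z * (gen y * sn ?U v + parity ?U * Lie y v)"
    by (intro ext_eq_refl gen gen_br_anti ext_eq_mult ext_eq_add ext_eq_diff)
  also have "\<dots> = (gen (br y z) * U) * v - gen y * Lie z U * v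
      + (gen z * gen y) * sn ?U v + (gen z * U) * Lie y v"
    by (simp add: algebra_simps)
  also have "\<dots> \<asymp> (?U * gen (br y z)) * v - gen y * Lie z U * v
      + (- (gen y * gen z)) * sn ?U v + (?U * gen z) * Lie y v"
    by (intro ext_eq_refl gen_graded_commute gen_anticommute ext_eq_mult ext_eq_add ext_eq_diff)
  also have "\<dots> = gen y * sn U (gen z * v) + parity U * Lie y (gen z * v)"
    by (simp add: sn_gen_mult_right Lie_gen_mult algebra_simps)
  finally show ?case .
next
  case (add u v)
  then show ?case using ext_eq_add[OF add(1)[of U] add(2)[of U]] by (simp add: sn_add Lie_add algebra_simps)
qed

text \<open>The recursion in \<open>Q\<close> on the left is compared with
  \<open>sn_gen_mult_left\<close> on the right; the Lie terms agree after moving the odd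
  \<open>Lie y P\<close> past \<open>U\<close>. For odd \<open>P\<close> the sign does not depend on
  the degree of \<open>Q\<close>.\<close>

lemma sn_antisym_odd:
  assumes "parity P = - P"
  shows "sn P Q \<asymp> - sn Q P"
proof (induction Q rule: free_alg_induct)
  case (scal a)
  then show ?case using assms by (simp add: sn_scal_left rcontract_def)
next
  case (gen y U)
  have odd: "Lie y P * U \<asymp> parity U * Lie y P"
    by (rule odd_commute) (simp add: parity_Lie assms)
  have "sn P (gen y * U) = - (Lie y P * U) + gen y * sn P U"
    by (simp add: sn_gen_mult_right assms)
  also have "\<dots> \<asymp> - (parity U * Lie y P) + gen y * - sn U P"
    by (intro ext_eq_refl odd gen ext_eq_uminus ext_eq_mult[OF ext_eq_refl] ext_eq_add)
  also have "\<dots> = - (gen y * sn U P + parity U * Lie y P)" by simp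
  also have "\<dots> \<asymp> - sn (gen y * U) P"
    by (intro ext_eq_uminus ext_eq_sym[OF sn_gen_mult_left])
  finally show ?case .
next
  case (add u v)
  then show ?case using ext_eq_add[OF add] by (simp add: sn_add sn_add_left)
qed

text \<open>For even \<open>p\<close> the sign \<open>-(-1)^((p-1)(q-1))\<close> equals
  \<open>(-1)^q\<close>, which is expressed by \<open>parity Q\<close>.\<close>

lemma sn_antisym_even:
  assumes "parity P = P"
  shows "sn P Q \<asymp> sn (parity Q) P"
proof (induction Q rule: free_alg_induct)
  case (scal a)
  then show ?case using assms by (simp add: sn_scal_left rcontract_def)
next
  case (gen y U)
  have even: "Lie y P * U \<asymp> U * Lie y P"
    by (rule even_commute) (simp add: parity_Lie assms)
  have "sn P (gen y * U) = - (Lie y P * U) - gen y * sn P U"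
    by (simp add: sn_gen_mult_right assms)
  also have "\<dots> \<asymp> - (U * Lie y P) - gen y * sn (parity U) P"
    by (intro ext_eq_refl even gen ext_eq_uminus ext_eq_mult[OF ext_eq_refl] ext_eq_diff)
  also have "\<dots> = - (gen y * sn (parity U) P + parity (parity U) * Lie y P)" by simp
  also have "\<dots> \<asymp> - sn (gen y * parity U) P"
    by (intro ext_eq_uminus ext_eq_sym[OF sn_gen_mult_left])
  finally show ?case by simp
next
  case (add u v)
  then show ?case using ext_eq_add[OF add] by (simp add: sn_add sn_add_left parity_add)
qed

text \<open>The flags \<open>a\<close> and \<open>b\<close> mark even arguments:
  \<open>-(-1)^((p-1)(q-1))\<close> is 1 exactly when both degrees are even.\<close>

lemma sn_antisym:
  assumes "parity P = (if a then P else - P)" "parity Q = (if b then Q else - Q)"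
  shows "sn P Q \<asymp> (if a \<and> b then sn Q P else - sn Q P)"
  using sn_antisym_odd[of P Q] sn_antisym_even[of P Q] assms by (cases a; cases b; simp)

subsection \<open>The graded Jacobi identity\<close>

text \<open>\<open>sn P\<close> shifts degrees by \<open>p - 1\<close>, so it is an odd derivation
  for even \<open>P\<close>.\<close>

lemma sn_Leibniz:
  assumes "parity P = (if a then P else - P)"
  shows "sn P (u * v) \<asymp> sn P u * v + (if a then parity u else u) * sn P v"
proof (induction u rule: free_alg_induct)
  case (scal b)
  then show ?case using sn_scal_mult_right[of P b v] by simp
next
  case (gen y u)
  let ?t = "\<lambda>u. if a then parity u else u"
  have "sn P (gen y * u * v) = - Lie y P * u * v - gen y * (if a then 1 else - 1) * sn P (u * v)"
    by (simp add: sn_gen_mult_right assms mult.assoc)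
  also have "\<dots> \<asymp> - Lie y P * u * v - gen y * (if a then 1 else - 1) * (sn P u * v + ?t u * sn P v)"
    by (intro ext_eq_refl gen ext_eq_mult[OF ext_eq_refl] ext_eq_diff)
  also have "\<dots> = sn P (gen y * u) * v + ?t (gen y * u) * sn P v"
    by (simp add: sn_gen_mult_right assms algebra_simps)
  finally show ?case .
next
  case (add u w)
  then show ?case
    using ext_eq_add[OF add] by (cases a) (simp_all add: sn_add parity_add algebra_simps)
qed

lemma sn_Jacobi_derivation:
  assumes P: "parity P = (if a then P else - P)" and Q: "parity Q = (if b then Q else - Q)"
  shows "sn P (sn Q R) \<asymp> sn (sn P Q) R + (if a \<and> b then - sn Q (sn P R) else sn Q (sn P R))"
proof (induction R rule: free_alg_induct)
  case (scal c)
  \<comment> \<open>Contraction lowers the degree by one, so the flag flips.\<close>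
  have *: "parity (rcontract c P) = (if \<not> a then rcontract c P else - rcontract c P)"
    using P by (simp add: parity_rcontract)
  \<comment> \<open>The subtracted term completes \<open>rcontract_sn\<close>; its re-added copy is
    then reversed by antisymmetry.\<close>
  have "sn P (rcontract c Q) = sn P (rcontract c Q) - sn (rcontract c P) (parity Q)
      + (if b then 1 else - 1) * sn (rcontract c P) Q"
    using Q by simp
  also have "\<dots> \<asymp> rcontract c (sn P Q) + (if b then 1 else - 1) *
      (if \<not> a \<and> b then sn Q (rcontract c P) else - sn Q (rcontract c P))"
    by (intro ext_eq_add ext_eq_mult[OF ext_eq_refl] ext_eq_sym[OF rcontract_sn] sn_antisym[OF * Q])
  also have "\<dots> = sn (sn P Q) (scal c) + (if a \<and> b then - sn Q (sn P (scal c)) else sn Q (sn P (scal c)))"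
    by simp
  finally show ?case by simp
next
  case (gen y u)
  \<comment> \<open>\<open>?s\<close> is \<open>(-1)^((p-1)(q-1))\<close>, and \<open>?e\<close> is
    the sign \<open>(-1)^(p+q)\<close> of passing \<open>gen y\<close> through both
    brackets.\<close>
  let ?s = "if a \<and> b then - 1 else 1 :: ('g, 'a) free_alg"
  let ?e = "if a = b then 1 else - 1 :: ('g, 'a) free_alg"
  let ?LP = "Lie y P" and ?LQ = "Lie y Q"
  have LP: "parity ?LP = (if a then ?LP else - ?LP)" and LQ: "parity ?LQ = (if b then ?LQ else - ?LQ)"
    using P Q by (simp_all add: parity_Lie)
  \<comment> \<open>\<open>?d\<close> lists the errors of the congruences used: Leibniz for
    \<open>sn Q\<close> and \<open>sn P\<close>, compatibility with \<open>Lie y\<close>,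
    antisymmetry, and the induction hypothesis. The Jacobi defect equals their sum already in the
    free algebra.\<close>
  let ?d = "?s * (sn Q (?LP * u) - (sn Q ?LP * u + (if b then parity ?LP else ?LP) * sn Q u))
     - (sn P (?LQ * u) - (sn P ?LQ * u + (if a then parity ?LQ else ?LQ) * sn P u))
     + (Lie y (sn P Q) - (sn ?LP Q + sn P ?LQ)) * u
     + (sn ?LP Q - (if a \<and> b then sn Q ?LP else - sn Q ?LP)) * u
     + ?e * (gen y * (sn P (sn Q u) - (sn (sn P Q) u + (if a \<and> b then - sn Q (sn P u) else sn Q (sn P u)))))"
  show ?case
  proof (rule ext_eqI)
    show "?d \<in> ext_ideal sA"
      by (intro ext_ideal_add ext_ideal_diff[of "?s * _"] ext_ideal_mult_left
        ext_ideal_mult_right[where s = u]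
        sn_Leibniz[OF P, unfolded ext_eq_def] sn_Leibniz[OF Q, unfolded ext_eq_def]
        Lie_sn[unfolded ext_eq_def] sn_antisym[OF LP Q, unfolded ext_eq_def] gen[unfolded ext_eq_def])
    show "sn P (sn Q (gen y * u)) - (sn (sn P Q) (gen y * u)
        + (if a \<and> b then - sn Q (sn P (gen y * u)) else sn Q (sn P (gen y * u)))) = ?d"
      using P Q LP LQ
      by (cases a; cases b) (simp_all add: sn_gen_mult_right sn_diff_right sn_add parity_sn algebra_simps)
  qed
next
  case (add u v)
  then show ?case
    using ext_eq_add[OF add] by (cases "a \<and> b") (auto simp: sn_add algebra_simps)
qed

text \<open>Antisymmetry makes the derivation form cyclic by reversing the outer bracket of
  \<open>sn (sn P Q) R\<close> and the inner one of \<open>sn Q (sn P R)\<close>. The signs are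
  compared in the eight parity cases.\<close>

lemma sn_Jacobi_cyclic:
  assumes P: "parity P = (if a then P else - P)" and Q: "parity Q = (if b then Q else - Q)"
    and R: "parity R = (if c then R else - R)"
  shows "(if a \<and> c then - 1 else 1) * sn P (sn Q R) + (if b \<and> a then - 1 else 1) * sn Q (sn R P)
    + (if c \<and> b then - 1 else 1) * sn R (sn P Q) \<in> ext_ideal sA"
    (is "?sac * _ + _ + _ \<in> _")
proof -
  \<comment> \<open>The degree \<open>p + q - 1\<close> is even exactly when \<open>p\<close> and
    \<open>q\<close> differ in parity.\<close>
  have PQ: "parity (sn P Q) = (if a \<noteq> b then sn P Q else - sn P Q)"
    using P Q by (simp add: parity_sn)
  let ?s = "if a \<and> b then - 1 else 1 :: ('g, 'a) free_alg"
  let ?d = "?sac * (sn P (sn Q R) - (sn (sn P Q) R + (if a \<and> b then - sn Q (sn P R) else sn Q (sn P R))))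
    + ?sac * (sn (sn P Q) R - (if a \<noteq> b \<and> c then sn R (sn P Q) else - sn R (sn P Q)))
    + ?sac * (?s * sn Q (sn P R - (if a \<and> c then sn R P else - sn R P)))"
  have "?d \<in> ext_ideal sA"
    by (intro ext_ideal_add ext_ideal_mult_left sn_ideal_right sn_Jacobi_derivation[OF P Q, unfolded ext_eq_def]
      sn_antisym[OF P R, unfolded ext_eq_def] sn_antisym[OF PQ R, unfolded ext_eq_def])
  also have "?d = ?sac * sn P (sn Q R) + (if b \<and> a then - 1 else 1) * sn Q (sn R P)
    + (if c \<and> b then - 1 else 1) * sn R (sn P Q)"
    by (cases a; cases b; cases c) (simp_all add: sn_diff_right sn_add)
  finally show ?thesis .
qed

subsection \<open>The bracket of words\<close>

lemma contract_word:
  "contract a (word xs) = (\<Sum>i<length xs. scal ((- 1) ^ i * \<rho> (xs ! i) a) * word (omit i xs))"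
proof (induction xs)
  case Nil
  then show ?case using contract_scal[of a 1] by simp
next
  case (Cons x xs)
  then show ?case
    by (simp add: word_Cons contract_gen_mult sum.lessThan_Suc_shift sum_distrib_left scal_minus
        move_scal sum_negf del: sum.lessThan_Suc)
qed

text \<open>The exponent counts the letters to the right of position \<open>i\<close>; for the first
  letter the sign comes from \<open>parity_word\<close>.\<close>

lemma rcontract_word:
  "rcontract a (word xs) = (\<Sum>i<length xs.
     scal ((- 1) ^ (length xs - Suc i) * \<rho> (xs ! i) a) * word (omit i xs))"
proof (induction xs)
  case Nil
  then show ?case using rcontract_scal[of a 1] by simp
next
  case (Cons x xs)
  have "scal (\<rho> x a) * (scal ((- 1) ^ length xs) * word xs)
      = scal ((- 1) ^ length xs * \<rho> x a) * word xs"
    by (simp add: scal_mult scal_ac mult.assoc)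
  with Cons show ?case
    by (simp add: word_Cons rcontract_gen_mult parity_word sum.lessThan_Suc_shift
        sum_distrib_left move_scal del: sum.lessThan_Suc)
qed

text \<open>The derivation replaces the letter at position \<open>i\<close>; moving the new letter
  to the front crosses \<open>i\<close> letters.\<close>

lemma Lie_word:
  "Lie y (word xs) \<asymp>
    (\<Sum>i<length xs. scal ((- 1) ^ i) * (gen (br y (xs ! i)) * word (omit i xs)))"
proof (induction xs)
  case Nil
  then show ?case using Lie_scal[of y 1] by simp
next
  case (Cons x xs)
  let ?s = "\<lambda>i. scal ((- 1) ^ i)" and ?g = "\<lambda>i. gen (br y (xs ! i))" and ?w = "\<lambda>i. word (omit i xs)"
  have "Lie y (word (x # xs)) = gen (br y x) * word xs + gen x * Lie y (word xs)"
    by (simp add: word_Cons Lie_gen_mult)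
  also have "\<dots> \<asymp> gen (br y x) * word xs + gen x * (\<Sum>i<length xs. ?s i * (?g i * ?w i))"
    by (intro ext_eq_refl ext_eq_add ext_eq_mult Cons.IH)
  also have "\<dots> = gen (br y x) * word xs + (\<Sum>i<length xs. ?s i * ((gen x * ?g i) * ?w i))"
    by (simp add: sum_distrib_left move_scal mult.assoc)
  also have "\<dots> \<asymp> gen (br y x) * word xs + (\<Sum>i<length xs. ?s i * (- (?g i * gen x) * ?w i))"
    by (intro ext_eq_refl ext_eq_add ext_eq_sum ext_eq_mult gen_anticommute)
  also have "\<dots> = (\<Sum>i<length (x # xs). ?s i * (gen (br y ((x # xs) ! i)) * word (omit i (x # xs))))"
    by (simp add: word_Cons sum.lessThan_Suc_shift scal_minus mult.assoc del: sum.lessThan_Suc)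
  finally show ?case .
qed

lemma rcontract_one: "rcontract 1 u = 0"
  using rcontract_index_mult[of 1 1 u] by simp

lemma rcontract_constant: "(\<And>x. \<rho> x k = 0) \<Longrightarrow> rcontract k u = 0"
  by (induction u rule: free_alg_induct) (simp_all add: rcontract_add rcontract_gen_mult)

text \<open>Linearity over the constants, the elements killed by all anchors. It is applied to signs
  and to the image of \<open>K\<close> in \<open>A\<close>.\<close>

lemma sn_scal_mult_left: "(\<And>x. \<rho> x k = 0) \<Longrightarrow> sn (scal k * P) u = scal k * sn P u"
  by (induction u arbitrary: P rule: free_alg_induct)
    (simp_all add: rcontract_scal_mult sn_gen_mult_right Lie_scal_mult sn_add move_scal algebra_simps)

lemma anchor_sign: "\<rho> x ((- 1) ^ n) = 0"
  by (simp add: minus_one_power_iff anchor_minus)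

text \<open>The Lie derivative along the first letter of \<open>ys\<close> yields the summands with
  \<open>j = 0\<close>; the recursive call yields the others, once \<open>gen y\<close> is moved
  back to its place.\<close>

lemma sn_word:
  "sn (word xs) (word ys) \<asymp> (\<Sum>i<length xs. \<Sum>j<length ys.
     scal ((- 1) ^ (Suc i + Suc j)) * (gen (br (xs ! i) (ys ! j)) * word (omit i xs) * word (omit j ys)))"
proof (induction ys)
  case Nil
  then show ?case using sn_scal[of "word xs" 1] by (simp add: rcontract_one)
next
  case (Cons y ys)
  let ?n = "length xs" and ?m = "length ys" and ?X = "word xs"
  let ?g = "\<lambda>i j. gen (br (xs ! i) (ys ! j)) * word (omit i xs)"
  have Lie: "- Lie y ?X \<asymp> (\<Sum>i<?n. scal ((- 1) ^ i) * (gen (br (xs ! i) y) * word (omit i xs)))"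
  proof -
    have "- Lie y ?X \<asymp> - (\<Sum>i<?n. scal ((- 1) ^ i) * (gen (br y (xs ! i)) * word (omit i xs)))"
      by (intro ext_eq_uminus Lie_word)
    also have "\<dots> = (\<Sum>i<?n. scal ((- 1) ^ i) * (- gen (br y (xs ! i)) * word (omit i xs)))"
      by (simp add: sum_negf)
    also have "\<dots> \<asymp> (\<Sum>i<?n. scal ((- 1) ^ i) * (gen (br (xs ! i) y) * word (omit i xs)))"
      by (intro ext_eq_sum ext_eq_mult ext_eq_refl gen_br_anti)
    finally show ?thesis .
  qed
  \<comment> \<open>\<open>?g i j\<close> has \<open>?n\<close> letters: the new one and those left
    of \<open>xs\<close>. The sign cancels, by \<open>sq\<close>, against the one from the parity
    twist.\<close>
  have move: "gen y * ?g i j \<asymp> scal ((- 1) ^ ?n) * (?g i j * gen y)" if "i < ?n" for i j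
  proof -
    have par: "parity (?g i j) = scal ((- 1) ^ ?n) * ?g i j"
      using length_omit[OF that] by (simp add: parity_word move_scal scal_minus mult.assoc)
    show ?thesis
      using gen_graded_commute[of sA y "?g i j"] unfolding par by (simp only: mult.assoc)
  qed
  have sq: "scal ((- 1) ^ ?n) * (scal ((- 1) ^ ?n) * u) = u" for u :: "('g, 'a) free_alg"
    by (simp add: mult.assoc[symmetric] scal_mult[symmetric] power_add[symmetric] flip: mult_2)
  have "sn ?X (word (y # ys)) = - Lie y ?X * word ys - scal ((- 1) ^ ?n) * (gen y * sn ?X (word ys))"
    by (simp add: word_Cons sn_gen_mult_right parity_word sn_scal_mult_left anchor_sign move_scal)
  also have "\<dots> \<asymp> - Lie y ?X * word ys - scal ((- 1) ^ ?n) * (gen y *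
      (\<Sum>i<?n. \<Sum>j<?m. scal ((- 1) ^ (Suc i + Suc j)) * (?g i j * word (omit j ys))))"
    by (intro ext_eq_diff ext_eq_mult ext_eq_refl Cons.IH)
  also have "\<dots> = - Lie y ?X * word ys - (\<Sum>i<?n. \<Sum>j<?m. scal ((- 1) ^ (Suc i + Suc j)) *
      (scal ((- 1) ^ ?n) * ((gen y * ?g i j) * word (omit j ys))))"
    by (simp add: sum_distrib_left mult.assoc move_scal scal_ac)
  also have "\<dots> \<asymp> (\<Sum>i<?n. scal ((- 1) ^ i) * (gen (br (xs ! i) y) * word (omit i xs))) * word ys
      - (\<Sum>i<?n. \<Sum>j<?m. scal ((- 1) ^ (Suc i + Suc j)) *
      (scal ((- 1) ^ ?n) * ((scal ((- 1) ^ ?n) * (?g i j * gen y)) * word (omit j ys))))"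
    by (intro ext_eq_diff ext_eq_sum ext_eq_mult[OF ext_eq_refl] ext_eq_mult[OF _ ext_eq_refl]
      ext_eq_refl Lie move) simp
  also have "\<dots> = (\<Sum>i<?n. scal ((- 1) ^ i) * (gen (br (xs ! i) y) * word (omit i xs) * word ys)
      - (\<Sum>j<?m. scal ((- 1) ^ (Suc i + Suc j)) * (?g i j * (gen y * word (omit j ys)))))"
    by (simp add: sum_subtractf sum_distrib_right mult.assoc sq)
  also have "\<dots> = (\<Sum>i<?n. \<Sum>j<length (y # ys). scal ((- 1) ^ (Suc i + Suc j)) *
      (gen (br (xs ! i) ((y # ys) ! j)) * word (omit i xs) * word (omit j (y # ys))))"
    by (simp add: sum.lessThan_Suc_shift word_Cons sum_negf scal_minus mult.assoc del: sum.lessThan_Suc)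
  finally show ?case .
qed

end

section \<open>The exterior algebra as a quotient\<close>

lemma ext_class_alt: "ext_class sA u = (\<lambda>h. h + u) ` ext_ideal sA"
  by (auto simp: ext_class_def a_r_coset_def' ring_of_type_algebra_def)

lemma ext_class_eq_iff: "ext_class sA u = ext_class sA v \<longleftrightarrow> ext_eq sA u v"
proof
  assume "ext_class sA u = ext_class sA v"
  moreover have "u \<in> ext_class sA u"
    unfolding ext_class_alt using ext_ideal_zero by force
  ultimately show "ext_eq sA u v"
    by (auto simp: ext_class_alt ext_eq_def)
next
  have sub: "ext_class sA u \<subseteq> ext_class sA v" if "ext_eq sA u v" for u v
  proof
    fix w assume "w \<in> ext_class sA u"
    then have "w - v \<in> ext_ideal sA"
      using that by (auto simp: ext_class_alt ext_eq_def add_diff_eq[symmetric] intro: ext_ideal_add)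
    then show "w \<in> ext_class sA v"
      unfolding ext_class_alt by (intro image_eqI[where x = "w - v"]) simp_all
  qed
  assume "ext_eq sA u v"
  then show "ext_class sA u = ext_class sA v"
    using sub ext_eq_sym by blast
qed

lemma ext_class_ring_hom: "ext_class sA \<in> ring_hom ring_of_type_algebra (ext_alg sA)"
  using ideal.rcos_ring_hom[OF ideal_ext_ideal[of sA]]
  unfolding ext_alg_def ext_class_def[abs_def] .

lemma ext_class_add: "ext_class sA (u + v) = ext_class sA u \<oplus>\<^bsub>ext_alg sA\<^esub> ext_class sA v"
  and ext_class_mult: "ext_class sA (u * v) = ext_class sA u \<otimes>\<^bsub>ext_alg sA\<^esub> ext_class sA v"
  and ext_class_1: "ext_class sA 1 = \<one>\<^bsub>ext_alg sA\<^esub>"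
  and ext_class_closed [simp]: "ext_class sA u \<in> carrier (ext_alg sA)"
  using ring_hom_add[OF ext_class_ring_hom, of u v] ring_hom_mult[OF ext_class_ring_hom, of u v]
    ring_hom_one[OF ext_class_ring_hom] ring_hom_closed[OF ext_class_ring_hom, of u]
  by (simp_all add: ring_of_type_algebra_def)

lemma ext_class_0: "ext_class sA 0 = \<zero>\<^bsub>ext_alg sA\<^esub>"
  by (simp add: ext_class_alt ext_alg_def FactRing_def)

lemma ext_class_eq_0_iff: "ext_class sA u = \<zero>\<^bsub>ext_alg sA\<^esub> \<longleftrightarrow> u \<in> ext_ideal sA"
  using ext_class_eq_iff[of sA u 0] by (simp add: ext_class_0 ext_eq_def)

lemma carrier_ext_alg: "carrier (ext_alg sA) = range (ext_class sA)"
  by (auto simp: ext_alg_def FactRing_def A_RCOSETS_def' ext_class_def ring_of_type_algebra_def)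

lemma ext_class_sum:
  "(\<Oplus>\<^bsub>ext_alg sA\<^esub>i\<in>S. ext_class sA (h i)) = ext_class sA (\<Sum>i\<in>S. h i)"
proof -
  interpret ring "ext_alg sA" by (rule ring_ext_alg)
  show ?thesis
    by (induction S rule: infinite_finite_induct)
      (simp_all add: ext_class_0 ext_class_add finsum_infinite)
qed

lemma ext_of_A_alt: "ext_of_A sA a = ext_class sA (scal a)"
  and ext_of_G_alt: "ext_of_G sA x = ext_class sA (gen x)"
  by (simp_all add: ext_of_A_def ext_of_G_def scal_def gen_def)

lemma ext_scale_ext_class: "ext_scale sA a (ext_class sA u) = ext_class sA (scal a * u)"
  by (simp add: ext_scale_def ext_of_A_alt ext_class_mult)

lemma wedge_alt: "wedge sA xs = ext_class sA (word xs)"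
  by (induction xs) (simp_all add: wedge_def ext_of_G_alt ext_class_1 ext_class_mult word_Cons)

text \<open>The coefficient of a nonempty word is absorbed into its first letter, so scalars and
  nonempty wedges generate additively.\<close>

lemma ext_class_induct [case_names scal wedge add]:
  assumes scal: "\<And>a. P (ext_of_A sA a)" and wedge: "\<And>xs. xs \<noteq> [] \<Longrightarrow> P (wedge sA xs)"
    and add: "\<And>u v. P (ext_class sA u) \<Longrightarrow> P (ext_class sA v) \<Longrightarrow>
      P (ext_class sA u \<oplus>\<^bsub>ext_alg sA\<^esub> ext_class sA v)"
  shows "P (ext_class sA u)"
proof (induction u rule: free_alg_single_induct)
  case (single xs a)
  show ?case
  proof (cases xs)
    case Nil
    then show ?thesis using scal[of a] by (simp add: ext_of_A_def zero_gword_def)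
  next
    case (Cons x ys)
    have "ext_eq sA (gen (sA a x) * word ys) (scal a * gen x * word ys)"
      by (intro ext_eq_mult gen_scale ext_eq_refl)
    then have "ext_class sA (Poly_Mapping.single (GWord xs) a) = wedge sA (sA a x # ys)"
      by (simp add: Cons wedge_alt ext_class_eq_iff single_eq_scal_word word_Cons mult.assoc ext_eq_sym)
    then show ?thesis using wedge by simp
  qed
qed (simp add: ext_class_add add)

text \<open>Additivity in both arguments reduces the claim to scalars and nonempty wedges, where the
  defining formulas prescribe the value.\<close>

lemma is_schouten_bracket_unique:
  assumes "is_schouten_bracket sK sA br \<rho> B" "is_schouten_bracket sK sA br \<rho> B'"
  shows "B (ext_class sA u) (ext_class sA v) = B' (ext_class sA u) (ext_class sA v)"
proof -
  have add_left: "C (ext_class sA u \<oplus>\<^bsub>ext_alg sA\<^esub> ext_class sA u') (ext_class sA v)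
      = C (ext_class sA u) (ext_class sA v) \<oplus>\<^bsub>ext_alg sA\<^esub> C (ext_class sA u') (ext_class sA v)"
    and add_right: "C (ext_class sA v) (ext_class sA u \<oplus>\<^bsub>ext_alg sA\<^esub> ext_class sA u')
      = C (ext_class sA v) (ext_class sA u) \<oplus>\<^bsub>ext_alg sA\<^esub> C (ext_class sA v) (ext_class sA u')"
    if "is_schouten_bracket sK sA br \<rho> C" for C u u' v
    using that unfolding is_schouten_bracket_def ext_K_linear_def by simp_all
  note add = add_left[OF assms(1)] add_left[OF assms(2)] add_right[OF assms(1)] add_right[OF assms(2)]
  note rules = assms[unfolded is_schouten_bracket_def]
  have A: "B (ext_of_A sA a) (ext_class sA v) = B' (ext_of_A sA a) (ext_class sA v)" for a v
    by (induction v rule: ext_class_induct) (use rules add(3,4) in \<open>simp_all add: ext_of_A_alt\<close>)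
  have W: "B (wedge sA xs) (ext_class sA v) = B' (wedge sA xs) (ext_class sA v)" if "xs \<noteq> []" for xs v
    by (induction v rule: ext_class_induct) (use rules add(3,4) that in \<open>simp_all add: wedge_alt\<close>)
  show ?thesis
    by (induction u rule: ext_class_induct) (simp_all add: A W add)
qed

section \<open>The bracket on the exterior algebra\<close>

context lie_rinehart
begin

text \<open>The choice of representatives is harmless by \<open>sn_cong\<close>.\<close>

definition ext_sn :: "('g, 'a) free_alg set \<Rightarrow> ('g, 'a) free_alg set \<Rightarrow> ('g, 'a) free_alg set"
  where "ext_sn U V = ext_class sA (sn (SOME u. ext_class sA u = U) (SOME v. ext_class sA v = V))"

lemma ext_sn_ext_class: "ext_sn (ext_class sA u) (ext_class sA v) = ext_class sA (sn u v)"
proof -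
  have "ext_class sA (SOME u'. ext_class sA u' = ext_class sA u) = ext_class sA u" for u
    by (rule someI) (rule refl)
  then show ?thesis
    unfolding ext_sn_def ext_class_eq_iff by (intro sn_cong)
qed

lemma is_schouten_bracket_ext_sn: "is_schouten_bracket sK sA br \<rho> ext_sn"
proof -
  let ?E = "ext_alg sA"
  \<comment> \<open>Derivations kill the image of \<open>K\<close>, so \<open>K\<close>-linearity
    holds although over \<open>A\<close> there is only a Leibniz rule.\<close>
  have const: "\<rho> x (sK c 1) = 0" for x c
    by (simp add: anchor_scaleK)
  have right: "ext_K_linear sK sA (\<lambda>V. ext_sn U V)" if "U \<in> carrier ?E" for U
  proof -
    from that obtain u where U: "U = ext_class sA u" by (auto simp: carrier_ext_alg)
    have "sn u (scal (sK c 1) * v) \<asymp> scal (sK c 1) * sn u v" for c v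
      using sn_scal_mult_right[of u "sK c 1" v] by (simp add: rcontract_constant const)
    then show ?thesis
      unfolding ext_K_linear_def U carrier_ext_alg
      by (auto simp: ext_sn_ext_class ext_class_add[symmetric] ext_scaleK_def ext_scale_ext_class
          sn_add ext_class_eq_iff)
  qed
  have left: "ext_K_linear sK sA (\<lambda>U. ext_sn U V)" if "V \<in> carrier ?E" for V
  proof -
    from that obtain v where V: "V = ext_class sA v" by (auto simp: carrier_ext_alg)
    show ?thesis
      unfolding ext_K_linear_def V carrier_ext_alg
      by (auto simp: ext_sn_ext_class ext_class_add[symmetric] ext_scaleK_def ext_scale_ext_class
          sn_add_left sn_scal_mult_left const)
  qed
  have "ext_sn (wedge sA xs) (wedge sA ys) =
      (\<Oplus>\<^bsub>?E\<^esub>i\<in>{..<length xs}. \<Oplus>\<^bsub>?E\<^esub>j\<in>{..<length ys}.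
        ext_scale sA ((-1) ^ (Suc i + Suc j))
          (ext_of_G sA (br (xs ! i) (ys ! j)) \<otimes>\<^bsub>?E\<^esub> wedge sA (omit i xs)
            \<otimes>\<^bsub>?E\<^esub> wedge sA (omit j ys)))" for xs ys
    unfolding wedge_alt ext_of_G_alt ext_class_mult[symmetric] ext_scale_ext_class ext_class_sum
      ext_sn_ext_class ext_class_eq_iff
    by (rule sn_word)
  moreover have "ext_sn (wedge sA xs) (ext_of_A sA a) =
      (\<Oplus>\<^bsub>?E\<^esub>i\<in>{..<length xs}.
        ext_scale sA ((-1) ^ (length xs - Suc i) * \<rho> (xs ! i) a) (wedge sA (omit i xs)))" for xs a
    unfolding wedge_alt ext_of_A_alt ext_scale_ext_class ext_class_sum ext_sn_ext_class
    by (simp add: rcontract_word)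
  moreover have "ext_sn (ext_of_A sA a) (wedge sA xs) =
      (\<Oplus>\<^bsub>?E\<^esub>i\<in>{..<length xs}. ext_scale sA ((-1) ^ Suc i * \<rho> (xs ! i) a) (wedge sA (omit i xs)))" for xs a
    unfolding wedge_alt ext_of_A_alt ext_scale_ext_class ext_class_sum ext_sn_ext_class
    by (simp add: sn_scal_left contract_word sum_negf scal_minus)
  moreover have "ext_sn (ext_of_A sA a) (ext_of_A sA b) = \<zero>\<^bsub>?E\<^esub>" for a b
    by (simp add: ext_of_A_alt ext_sn_ext_class ext_class_0)
  ultimately show ?thesis
    unfolding is_schouten_bracket_def using left right by blast
qed

text \<open>Existence makes the choice in \<open>schouten\<close> satisfy the defining conditions;
  uniqueness then identifies it with \<open>ext_sn\<close> on classes.\<close>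

lemma schouten_ext_class:
  "schouten sK sA br \<rho> (ext_class sA u) (ext_class sA v) = ext_class sA (sn u v)"
proof -
  have "is_schouten_bracket sK sA br \<rho> (schouten sK sA br \<rho>)"
    unfolding schouten_def
    by (rule someI[where P = "is_schouten_bracket sK sA br \<rho>", OF is_schouten_bracket_ext_sn])
  from is_schouten_bracket_unique[OF this is_schouten_bracket_ext_sn]
  show ?thesis by (simp add: ext_sn_ext_class)
qed

end

text \<open>Negative \<open>p\<close> is covered: no word has that length, so
  \<open>u = 0\<close>.\<close>

lemma parity_homogeneous:
  assumes "\<forall>w\<in>Poly_Mapping.keys u. int (length (letters w)) = p"
  shows "parity u = (if even p then u else - u)"
proof -
  let ?s = "\<lambda>w. Poly_Mapping.single w (Poly_Mapping.lookup u w)"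
  have parity_sum: "parity (\<Sum>w\<in>S. h w) = (\<Sum>w\<in>S. parity (h w))" for S and h :: "'a gword \<Rightarrow> ('a, 'b) free_alg"
    by (induction S rule: infinite_finite_induct) (simp_all add: parity_add)
  have single: "parity (?s w) = (if even p then ?s w else - ?s w)" if "w \<in> Poly_Mapping.keys u" for w
  proof -
    have "even p \<longleftrightarrow> even (length (letters w))" using assms that by force
    moreover have "?s w = scal (Poly_Mapping.lookup u w) * word (letters w)"
      by (simp add: single_eq_scal_word[symmetric])
    ultimately show ?thesis
      by (simp add: parity_word scal_minus)
  qed
  have "parity u = (\<Sum>w\<in>Poly_Mapping.keys u. parity (?s w))"
    by (simp add: parity_sum[symmetric] free_alg_sum_singles)
  also have "\<dots> = (\<Sum>w\<in>Poly_Mapping.keys u. if even p then ?s w else - ?s w)"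
    by (intro sum.cong refl single)
  also have "\<dots> = (if even p then u else - u)"
    by (simp add: sum_negf free_alg_sum_singles)
  finally show ?thesis .
qed

text \<open>Exponents such as \<open>(p - 1) * (r - 1)\<close> are negative when one degree is 0 and
  the other exceeds 1.\<close>

lemma minus_one_powi: "(- 1 :: 'k::field) powi n = (if even n then 1 else - 1)"
  by (auto simp: power_int_def minus_one_power_iff even_nat_iff)

theorem theorem4p3:
  fixes sK :: "'k::field_char_0 \<Rightarrow> 'a::comm_ring_1 \<Rightarrow> 'a"
    and sA :: "'a \<Rightarrow> 'g::ab_group_add \<Rightarrow> 'g"
    and br :: "'g \<Rightarrow> 'g \<Rightarrow> 'g"
    and \<rho> :: "'g \<Rightarrow> 'a \<Rightarrow> 'a"
    and p q r :: int
    and P Q R :: "('g, 'a) free_alg set"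
  assumes "lie_rinehart sK sA br \<rho>"
    and "P \<in> ext_power sA p" and "Q \<in> ext_power sA q" and "R \<in> ext_power sA r"
  shows "ext_scaleK sK sA ((-1) powi ((p - 1) * (r - 1)))
           (schouten sK sA br \<rho> P (schouten sK sA br \<rho> Q R))
         \<oplus>\<^bsub>ext_alg sA\<^esub>
         ext_scaleK sK sA ((-1) powi ((q - 1) * (p - 1)))
           (schouten sK sA br \<rho> Q (schouten sK sA br \<rho> R P))
         \<oplus>\<^bsub>ext_alg sA\<^esub>
         ext_scaleK sK sA ((-1) powi ((r - 1) * (q - 1)))
           (schouten sK sA br \<rho> R (schouten sK sA br \<rho> P Q))
         = \<zero>\<^bsub>ext_alg sA\<^esub>"
proof -
  interpret lie_rinehart sK sA br \<rho> by fact
  obtain u v w where P: "P = ext_class sA u" "parity u = (if even p then u else - u)"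
    and Q: "Q = ext_class sA v" "parity v = (if even q then v else - v)"
    and R: "R = ext_class sA w" "parity w = (if even r then w else - w)"
    using assms(2-4) unfolding ext_power_def by (blast dest: parity_homogeneous)
  \<comment> \<open>The exponent is odd exactly when \<open>m\<close> and \<open>n\<close> are both
    even.\<close>
  have sign: "ext_scaleK sK sA ((- 1) powi ((m - 1) * (n - 1))) (ext_class sA t)
      = ext_class sA ((if even m \<and> even n then - 1 else 1) * t)" for m n t
    by (simp add: ext_scaleK_def minus_one_powi ext_scale_ext_class scal_minus)
  show ?thesis
    unfolding P(1) Q(1) R(1) schouten_ext_class sign ext_class_add[symmetric] ext_class_eq_0_iff
    by (rule sn_Jacobi_cyclic[OF P(2) Q(2) R(2)])
qed

end
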